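(* Let $\mathcal F$ be a finite set of finite tournaments, each with at least two vertices. Then: (1) there is a polynomial-time reduction from the $\mathcal F$-free orientation problem to $\mathrm{CSP}(\mathfrak B_{\mathcal F})$; (2) there is a polynomial-time reduction from the $\mathcal F$-free orientation completion problem to $\mathrm{CSP}(\mathfrak B_{\mathcal F},\mathbf 0,\mathbf 1)$.
   Context: An oriented graph is a loopless digraph with no pair $x,y$ such that both $(x,y)$ and $(y,x)$ are edges (such a pair is called a symmetric edge in a digraph); a tournament is an oriented graph in which every two distinct vertices are adjacent. An oriented graph is $\mathcal F$-free if no tournament of $\mathcal F$ embeds into it as an induced subdigraph. The $\mathcal F$-free orientation problem: given a finite graph $G$, decide whether $G$ has an $\mathcal F$-free orientation. The $\mathcal F$-free orientation completion problem: given a finite loopless digraph $D$, decide whether one can remove from each symmetric edge exactly one of its two directions so that the result is $\mathcal F$-free. Let $m_{\mathcal F}$ be the maximum number of vertices of a tournament in $\mathcal F$. For a tournament $T$ on $\{1,\dots,n\}$ let $b_T\in\{0,1\}^{\binom n2}$, indexed by pairs $i<j$, with $(b_T)_{ij}=1$ iff $(i,j)\in E(T)$. $\mathfrak B_{\mathcal F}$ is the structure with domain $\{0,1\}$ and, for each $n\in\{2,\dots,m_{\mathcal F}\}$, the $\binom n2$-ary relation $P_n=\{b_T: T$ an $\mathcal F$-free tournament on $\{1,\dots,n\}\}$; $(\mathfrak B_{\mathcal F},\mathbf 0,\mathbf 1)$ is its expansion by $\mathbf 0=\{0\}$ and $\mathbf 1=\{1\}$. $\mathrm{CSP}(\mathfrak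 B)$ is the problem of deciding whether a given finite structure of the signature of $\mathfrak B$ has a homomorphism to $\mathfrak B$. *)

theory Defs
  imports
    "Graph_Theory.Digraph_Component"
    "HOL-Computational_Algebra.Polynomial"
begin

section \<open>Oriented graphs, tournaments and orientations\<close>

text \<open>
  Finite loopless digraphs are the library's \<open>pair_digraph\<close>; finite simple graphs are its
  \<open>pair_graph\<close>, i.e. the symmetric ones among them, an edge \<open>xy\<close> being the pair of arcs \<open>(x,y)\<close>, \<open>(y,x)\<close>.
\<close>

definition oriented_graph :: "'a pair_pre_digraph \<Rightarrow> bool" where
  "oriented_graph D \<longleftrightarrow>
     pair_loopfree_digraph D \<and> (\<forall>x y. \<not> ((x, y) \<in> parcs D \<and> (y, x) \<in> parcs D))"

definition tournament :: "'a pair_pre_digraph \<Rightarrow> bool" where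
  "tournament T \<longleftrightarrow> oriented_graph T \<and>
     (\<forall>x\<in>pverts T. \<forall>y\<in>pverts T. x \<noteq> y \<longrightarrow> (x, y) \<in> parcs T \<or> (y, x) \<in> parcs T)"

definition embeds :: "'a pair_pre_digraph \<Rightarrow> 'b pair_pre_digraph \<Rightarrow> bool" where
  "embeds T D \<longleftrightarrow> (\<exists>f. inj_on f (pverts T) \<and> f ` pverts T \<subseteq> pverts D \<and>
     (\<forall>x\<in>pverts T. \<forall>y\<in>pverts T. (x, y) \<in> parcs T \<longleftrightarrow> (f x, f y) \<in> parcs D))"

definition free_of :: "'a pair_pre_digraph set \<Rightarrow> 'b pair_pre_digraph \<Rightarrow> bool" where
  "free_of F D \<longleftrightarrow> (\<forall>T\<in>F. \<not> embeds T D)"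

definition orientation_of :: "'a pair_pre_digraph \<Rightarrow> 'a pair_pre_digraph \<Rightarrow> bool" where
  "orientation_of D G \<longleftrightarrow> oriented_graph D \<and> mk_symmetric (with_proj D) = G"

definition orientation_completion_of :: "'a pair_pre_digraph \<Rightarrow> 'a pair_pre_digraph \<Rightarrow> bool" where
  "orientation_completion_of D' D \<longleftrightarrow>
     pverts D' = pverts D \<and> parcs D' \<subseteq> parcs D \<and>
     (\<forall>x y. (x, y) \<in> parcs D \<longrightarrow>
        (if (y, x) \<in> parcs D then (x, y) \<in> parcs D' \<longleftrightarrow> (y, x) \<notin> parcs D'
         else (x, y) \<in> parcs D'))"


section \<open>Relational structures\<close>

text \<open>A signature is the list of the arities of its relation symbols; a relation is a set of lists.\<close>

type_synonym signature = "nat list"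

record 'a rel_structure =
  univ :: "'a set"
  rels :: "'a list set list"

definition is_structure :: "signature \<Rightarrow> 'a rel_structure \<Rightarrow> bool" where
  "is_structure \<sigma> A \<longleftrightarrow> length (rels A) = length \<sigma> \<and>
     (\<forall>i<length \<sigma>. \<forall>t\<in>rels A ! i. length t = \<sigma> ! i \<and> set t \<subseteq> univ A)"

definition homomorphism :: "signature \<Rightarrow> ('a \<Rightarrow> 'b) \<Rightarrow> 'a rel_structure \<Rightarrow> 'b rel_structure \<Rightarrow> bool" where
  "homomorphism \<sigma> h A B \<longleftrightarrow> h ` univ A \<subseteq> univ B \<and>
     (\<forall>i<length \<sigma>. \<forall>t\<in>rels A ! i. map h t \<in> rels B ! i)"


section \<open>The Boolean structure of a set of tournaments\<close>

text \<open>The \<open>0\<close> only matters for the empty set, where there are no relation symbols \<open>P\<^sub>n\<close>.\<close>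

definition max_order :: "'a pair_pre_digraph set \<Rightarrow> nat" where
  "max_order F = Max (insert 0 ((\<lambda>T. card (pverts T)) ` F))"

text \<open>The index pairs \<open>i < j\<close> in \<open>{1..n}\<close>, in lexicographic order.\<close>

definition index_pairs :: "nat \<Rightarrow> (nat \<times> nat) list" where
  "index_pairs n = [(i, j). i \<leftarrow> [1..<Suc n], j \<leftarrow> [Suc i..<Suc n]]"

definition tournament_vec :: "nat \<Rightarrow> nat pair_pre_digraph \<Rightarrow> nat list" where
  "tournament_vec n T = map (\<lambda>e. if e \<in> parcs T then 1 else 0) (index_pairs n)"

definition free_tournament_rel :: "'a pair_pre_digraph set \<Rightarrow> nat \<Rightarrow> nat list set" where
  "free_tournament_rel F n =
     {tournament_vec n T | T. tournament T \<and> pverts T = {1..n} \<and> free_of F T}"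

definition bool_sig :: "'a pair_pre_digraph set \<Rightarrow> signature" where
  "bool_sig F = map (\<lambda>n. n choose 2) [2..<Suc (max_order F)]"

definition bool_structure :: "'a pair_pre_digraph set \<Rightarrow> nat rel_structure" where
  "bool_structure F =
     \<lparr>univ = {0, 1}, rels = map (free_tournament_rel F) [2..<Suc (max_order F)]\<rparr>"

definition bool_sig_consts :: "'a pair_pre_digraph set \<Rightarrow> signature" where
  "bool_sig_consts F = bool_sig F @ [1, 1]"

definition bool_structure_consts :: "'a pair_pre_digraph set \<Rightarrow> nat rel_structure" where
  "bool_structure_consts F =
     \<lparr>univ = univ (bool_structure F), rels = rels (bool_structure F) @ [{[0]}, {[1]}]\<rparr>"


section \<open>Turing machines\<close>

text \<open>
  Deterministic machines with finitely many two-way infinite tapes over the tape alphabet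
  \<open>None\<close> (blank), \<open>Some False\<close>, \<open>Some True\<close>. The states are \<open>0, \<dots>, states M\<close>; the machine starts
  in state \<open>0\<close> and halts in state \<open>states M\<close>. A transition maps the current state and the list of
  scanned symbols to the next state and, for every tape, the symbol written and the head move.
\<close>

datatype move = MoveLeft | Stay | MoveRight

fun displacement :: "move \<Rightarrow> int" where
  "displacement MoveLeft = -1"
| "displacement Stay = 0"
| "displacement MoveRight = 1"

record turing_machine =
  tapes :: nat
  states :: nat
  trans :: "nat \<Rightarrow> bool option list \<Rightarrow> nat \<times> (bool option \<times> move) list"

definition wf_turing_machine :: "turing_machine \<Rightarrow> bool" where
  "wf_turing_machine M \<longleftrightarrow> 0 < tapes M \<and>
     (\<forall>q<states M. \<forall>s. length s = tapes M \<longrightarrow>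
        fst (trans M q s) \<le> states M \<and> length (snd (trans M q s)) = tapes M)"

text \<open>A tape is its contents together with the position of the head.\<close>

type_synonym tape = "(int \<Rightarrow> bool option) \<times> int"

type_synonym config = "nat \<times> tape list"

fun tape_read :: "tape \<Rightarrow> bool option" where
  "tape_read (c, h) = c h"

fun tape_act :: "bool option \<times> move \<Rightarrow> tape \<Rightarrow> tape" where
  "tape_act (b, d) (c, h) = (c(h := b), h + displacement d)"

fun tm_step :: "turing_machine \<Rightarrow> config \<Rightarrow> config" where
  "tm_step M (q, ts) =
     (if q = states M then (q, ts)
      else (let (q', as) = trans M q (map tape_read ts) in (q', map2 tape_act as ts)))"

definition word_contents :: "bool list \<Rightarrow> int \<Rightarrow> bool option" where
  "word_contents w i = (if 0 \<le> i \<and> i < int (length w) then Some (w ! nat i) else None)"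

definition tm_init :: "turing_machine \<Rightarrow> bool list \<Rightarrow> config" where
  "tm_init M w = (0, (word_contents w, 0) # replicate (tapes M - 1) (word_contents [], 0))"

text \<open>
  The input is on the first tape and the output on the last one. Since halting configurations
  are fixed by \<open>tm_step\<close>, this says that \<open>M\<close> halts after at most \<open>t\<close> steps with output \<open>v\<close>.
\<close>

definition tm_computes_within :: "turing_machine \<Rightarrow> nat \<Rightarrow> bool list \<Rightarrow> bool list \<Rightarrow> bool" where
  "tm_computes_within M t w v \<longleftrightarrow>
     (case (tm_step M ^^ t) (tm_init M w) of
        (q, ts) \<Rightarrow> q = states M \<and> fst (last ts) = word_contents v)"


section \<open>Decision problems and polynomial-time reductions\<close>

record 'a decision_problem =
  instances :: "'a set"
  yes_instance :: "'a \<Rightarrow> bool"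
  encode :: "'a \<Rightarrow> bool list"

definition polytime_reduction ::
  "'a decision_problem \<Rightarrow> 'b decision_problem \<Rightarrow> ('a \<Rightarrow> 'b) \<Rightarrow> bool" where
  "polytime_reduction P Q r \<longleftrightarrow>
     (\<forall>x\<in>instances P. r x \<in> instances Q \<and> (yes_instance P x \<longleftrightarrow> yes_instance Q (r x))) \<and>
     (\<exists>M (p :: nat poly). wf_turing_machine M \<and>
        (\<forall>x\<in>instances P.
           tm_computes_within M (poly p (length (encode P x))) (encode P x) (encode Q (r x))))"

definition polytime_reducible :: "'a decision_problem \<Rightarrow> 'b decision_problem \<Rightarrow> bool" where
  "polytime_reducible P Q \<longleftrightarrow> (\<exists>r. polytime_reduction P Q r)"

text \<open>
  Standard encoding of a structure with universe \<open>{..<n}\<close>: the number \<open>n\<close> in unary, a delimiter,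
  and for each symbol of arity \<open>k\<close> the \<open>n ^ k\<close> bits of the characteristic function of its relation,
  with the tuples in lexicographic order. For a (di)graph, a structure with one binary relation,
  this is its adjacency matrix.
\<close>

definition encode_structure :: "signature \<Rightarrow> nat rel_structure \<Rightarrow> bool list" where
  "encode_structure \<sigma> A =
     (let n = card (univ A) in
        replicate n True @ [False] @
        concat (map2 (\<lambda>k R. map (\<lambda>t. t \<in> R) (product_lists (replicate k [0..<n]))) \<sigma> (rels A)))"

definition encode_digraph :: "nat pair_pre_digraph \<Rightarrow> bool list" where
  "encode_digraph D =
     encode_structure [2] \<lparr>univ = pverts D, rels = [{[x, y] | x y. (x, y) \<in> parcs D}]\<rparr>"

text \<open>
  As inputs have to be words, the instances are taken on initial segments of the naturals; every
  finite graph, digraph or structure is isomorphic to such an instance.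
\<close>

definition orientation_problem :: "'a pair_pre_digraph set \<Rightarrow> nat pair_pre_digraph decision_problem"
  where
  "orientation_problem F =
     \<lparr>instances = {G. pair_graph G \<and> (\<exists>n. pverts G = {..<n})},
      yes_instance = (\<lambda>G. \<exists>D. orientation_of D G \<and> free_of F D),
      encode = encode_digraph\<rparr>"

definition orientation_completion_problem ::
  "'a pair_pre_digraph set \<Rightarrow> nat pair_pre_digraph decision_problem" where
  "orientation_completion_problem F =
     \<lparr>instances = {D. pair_digraph D \<and> (\<exists>n. pverts D = {..<n})},
      yes_instance = (\<lambda>D. \<exists>D'. orientation_completion_of D' D \<and> free_of F D'),
      encode = encode_digraph\<rparr>"

definition CSP :: "signature \<Rightarrow> 'a rel_structure \<Rightarrow> nat rel_structure decision_problem" where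
  "CSP \<sigma> B =
     \<lparr>instances = {A. is_structure \<sigma> A \<and> (\<exists>n. univ A = {..<n})},
      yes_instance = (\<lambda>A. \<exists>h. homomorphism \<sigma> h A B),
      encode = encode_structure \<sigma>\<rparr>"

end

theory Submission
  imports Defs
begin

text \<open>
  The reduction sends a digraph on \<open>{..<n}\<close> to a structure on \<open>{..<n * n}\<close>, where \<open>x n + y\<close> with \<open>x < y\<close>
  is the variable that says whether the edge between \<open>x\<close> and \<open>y\<close> is directed from \<open>x\<close> to \<open>y\<close>. The
  tuples in \<open>P\<^sub>k\<close> come from the cliques \<open>x\<^sub>1 < \<dots> < x\<^sub>k\<close> of the underlying graph, and the constants fix
  the variables of the edges that are not symmetric. A tournament embeds into an orientation only on a
  clique, so the homomorphisms are exactly the orientations free of \<open>F\<close>. Every relation of this structure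
  is defined by a quantifier-free formula over \<open><\<close> and the edge relation; a machine prints its table by
  running through all tuples with nested loops, in lexicographic order, and testing the formula on each.
\<close>

section \<open>Structured programs for Turing machines\<close>

text \<open>Giving a variable to every pair, edge or not, makes the universe have size
  \<open>n * n\<close>. Base-\<open>n\<close> digits then turn a tuple of variables into a tuple of
  vertices without disturbing the order that the output encoding prescribes. The variables of
  non-edges and of pairs with \<open>x \<ge> y\<close> occur in no tuple, so their values are free.
  Since \<open>F\<close> is fixed, the number of tables and the nesting depth of the loops are
  constants. Testing every tuple is therefore polynomial, with a degree that depends on
  \<open>F\<close>. The time bound is an explicit step count for structured programs, and one
  translation theorem turns such a program into a machine. Both claims share their combinatorics:
  orienting a graph is the case of completion in which every edge is symmetric and the constants
  have nothing to fix.\<close>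

datatype prog =
    Act "(nat \<Rightarrow> bool option) \<Rightarrow> nat \<Rightarrow> bool option \<times> move"
  | Seq prog prog
  | While "(nat \<Rightarrow> bool option) \<Rightarrow> bool" prog
  | If "(nat \<Rightarrow> bool option) \<Rightarrow> bool" prog prog

definition stay :: "(nat \<Rightarrow> bool option) \<Rightarrow> nat \<Rightarrow> bool option \<times> move" where
  "stay r = (\<lambda>i. (r i, Stay))"

text \<open>
  A control state is a continuation, the list of programs still to be run. Only finitely many of
  them are reachable, so that they can be numbered by the states of a machine.
\<close>

fun next_cont :: "prog list \<Rightarrow> (nat \<Rightarrow> bool option) \<Rightarrow> prog list \<times> (nat \<Rightarrow> bool option \<times> move)"
where
  "next_cont [] r = ([], stay r)"
| "next_cont (Act a # K) r = (K, a r)"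
| "next_cont (Seq p q # K) r = (p # q # K, stay r)"
| "next_cont (While c p # K) r = (if c r then p # While c p # K else K, stay r)"
| "next_cont (If c p q # K) r = (if c r then p # K else q # K, stay r)"

text \<open>
  Tape vectors are functions; the tapes from \<open>k\<close> on do not exist and are never touched.
\<close>

definition reads :: "nat \<Rightarrow> (nat \<Rightarrow> tape) \<Rightarrow> nat \<Rightarrow> bool option" where
  "reads k s = (\<lambda>i. if i < k then tape_read (s i) else None)"

definition act_all :: "nat \<Rightarrow> (nat \<Rightarrow> bool option \<times> move) \<Rightarrow> (nat \<Rightarrow> tape) \<Rightarrow> nat \<Rightarrow> tape" where
  "act_all k a s = (\<lambda>i. if i < k then tape_act (a i) (s i) else s i)"

lemma tape_act_stay [simp]: "tape_act (tape_read u, Stay) u = u"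
  by (cases u) simp

lemma act_all_stay [simp]: "act_all k (stay (reads k s)) s = s"
  by (auto simp: act_all_def stay_def reads_def)

definition exec :: "nat \<Rightarrow> prog list \<times> (nat \<Rightarrow> tape) \<Rightarrow> prog list \<times> (nat \<Rightarrow> tape)" where
  "exec k = (\<lambda>(K, s). (fst (next_cont K (reads k s)), act_all k (snd (next_cont K (reads k s))) s))"

text \<open>The number \<open>t\<close> of steps is chosen before the continuation \<open>K\<close>,
  so that a run can be placed in front of any further program. \<open>T\<close> is only an upper
  bound, because the exact time varies with the branches taken.\<close>

definition runs :: "nat \<Rightarrow> prog \<Rightarrow> nat \<Rightarrow> (nat \<Rightarrow> tape) \<Rightarrow> (nat \<Rightarrow> tape) \<Rightarrow> bool" where
  "runs k p T s s' \<longleftrightarrow> (\<exists>t\<le>T. \<forall>K. (exec k ^^ t) (p # K, s) = (K, s'))"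

lemma runsI: "t \<le> T \<Longrightarrow> (\<And>K. (exec k ^^ t) (p # K, s) = (K, s')) \<Longrightarrow> runs k p T s s'"
  unfolding runs_def by blast

lemma runsE:
  assumes "runs k p T s s'"
  obtains t where "t \<le> T" "\<And>K. (exec k ^^ t) (p # K, s) = (K, s')"
  using assms unfolding runs_def by blast

lemma runs_mono: "runs k p T s s' \<Longrightarrow> T \<le> T' \<Longrightarrow> runs k p T' s s'"
  by (erule runsE, rule runsI, erule (1) le_trans)

lemma exec_trans:
  "(exec k ^^ t) c = c' \<Longrightarrow> (exec k ^^ u) c' = c'' \<Longrightarrow> (exec k ^^ (t + u)) c = c''"
  by (simp add: add.commute[of t u] funpow_add)

lemma exec_step:
  "exec k c = c' \<Longrightarrow> (exec k ^^ u) c' = c'' \<Longrightarrow> (exec k ^^ Suc u) c = c''"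
  by (simp only: funpow_Suc_right comp_apply)

lemma runs_Act: "act_all k (a (reads k s)) s = s' \<Longrightarrow> runs k (Act a) 1 s s'"
  by (rule runsI[of 1]) (simp_all add: exec_def)

text \<open>The extra step is the one in which the control unfolds \<open>Seq\<close>; the tapes do
  not change in it.\<close>

lemma runs_Seq:
  assumes "runs k p T s s1" "runs k q U s1 s2" "1 + T + U \<le> V"
  shows "runs k (Seq p q) V s s2"
proof -
  obtain t where t: "t \<le> T" "\<And>K. (exec k ^^ t) (p # K, s) = (K, s1)"
    by (rule runsE[OF assms(1)]) (rule that)
  obtain u where u: "u \<le> U" "\<And>K. (exec k ^^ u) (q # K, s1) = (K, s2)"
    by (rule runsE[OF assms(2)]) (rule that)
  have "(exec k ^^ Suc (t + u)) (Seq p q # K, s) = (K, s2)" for K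
    by (rule exec_step[OF _ exec_trans[OF t(2) u(2)]]) (simp add: exec_def)
  then show ?thesis by (rule runsI[rotated]) (use t(1) u(1) assms(3) in simp)
qed

lemma runs_If:
  assumes "c (reads k s) \<Longrightarrow> runs k p T s s'" "\<not> c (reads k s) \<Longrightarrow> runs k q T s s'" "1 + T \<le> V"
  shows "runs k (If c p q) V s s'"
proof -
  obtain t where t: "t \<le> T"
    "\<And>K. (exec k ^^ t) ((if c (reads k s) then p else q) # K, s) = (K, s')"
  proof (rule runsE)
    show "runs k (if c (reads k s) then p else q) T s s'" using assms(1,2) by simp
  qed (rule that)
  have "(exec k ^^ Suc t) (If c p q # K, s) = (K, s')" for K
    by (rule exec_step[OF _ t(2)]) (simp add: exec_def)
  then show ?thesis by (rule runsI[rotated]) (use t(1) assms(3) in simp)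
qed

text \<open>The sequence \<open>S\<close> plays the role of the loop invariant: \<open>S j\<close>
  is the state before round \<open>j\<close>. Each of the \<open>m + 1\<close> evaluations of the
  condition takes one step.\<close>

lemma runs_While:
  assumes "\<And>j. j < m \<Longrightarrow> c (reads k (S j))"
    and "\<And>j. j < m \<Longrightarrow> runs k b T (S j) (S (Suc j))"
    and "\<not> c (reads k (S m))" and "m * (T + 1) + 1 \<le> V"
  shows "runs k (While c b) V (S 0) (S m)"
proof -
  have "runs k (While c b) (m * (T + 1) + 1) (S 0) (S m)"
    using assms(1-3)
  proof (induction m arbitrary: S)
    case 0
    then have "(exec k ^^ 1) (While c b # K, S 0) = (K, S 0)" for K
      by (simp add: exec_def)
    then show ?case by (rule runsI[rotated]) simp
  next
    case (Suc m)
    have IH: "runs k (While c b) (m * (T + 1) + 1) (S (Suc 0)) (S (Suc m))"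
      using Suc.IH[of "\<lambda>j. S (Suc j)"] Suc.prems by simp
    obtain u where u: "u \<le> m * (T + 1) + 1"
      "\<And>K. (exec k ^^ u) (While c b # K, S (Suc 0)) = (K, S (Suc m))"
      by (rule runsE[OF IH]) (rule that)
    obtain t where t: "t \<le> T" "\<And>K. (exec k ^^ t) (b # K, S 0) = (K, S (Suc 0))"
      by (rule runsE[OF Suc.prems(2)[of 0]]) (auto intro: that)
    have "(exec k ^^ Suc (t + u)) (While c b # K, S 0) = (K, S (Suc m))" for K
      by (rule exec_step[OF _ exec_trans[OF t(2) u(2)]])
        (use Suc.prems(1)[of 0] in \<open>simp add: exec_def\<close>)
    then show ?case by (rule runsI[rotated]) (use t(1) u(1) in simp)
  qed
  then show ?thesis using assms(4) by (rule runs_mono)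
qed

section \<open>Translation of programs into Turing machines\<close>

fun conts :: "prog \<Rightarrow> prog list \<Rightarrow> prog list set" where
  "conts (Act a) K = {Act a # K}"
| "conts (Seq p q) K = insert (Seq p q # K) (conts p (q # K) \<union> conts q K)"
| "conts (While c p) K = insert (While c p # K) (conts p (While c p # K))"
| "conts (If c p q) K = insert (If c p q # K) (conts p K \<union> conts q K)"

text \<open>The body of a loop is followed by the loop itself with its old continuation, so a
  further round leads to no new control state, and recursion on the program exhausts them.\<close>

lemma finite_conts: "finite (conts p K)"
  by (induction p arbitrary: K) auto

lemma Cons_in_conts: "p # K \<in> conts p K"
  by (cases p) auto

lemma Nil_notin_conts: "[] \<notin> conts p K"
  by (induction p arbitrary: K) auto

lemma next_cont_in_conts: "C \<in> conts p K \<Longrightarrow> fst (next_cont C r) \<in> insert K (conts p K)"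
proof (induction p arbitrary: K)
  case (Seq p q)
  show ?case using Seq.prems Seq.IH(1)[of "q # K"] Seq.IH(2)[of K] Cons_in_conts[of q K]
      Cons_in_conts[of p "q # K"] by auto
next
  case (While c p)
  show ?case using While.prems While.IH[of "While c p # K"] Cons_in_conts[of p "While c p # K"]
    by (auto split: if_splits)
next
  case (If c p q)
  show ?case using If.prems If.IH(1)[of K] If.IH(2)[of K] Cons_in_conts[of p K] Cons_in_conts[of q K]
    by (auto split: if_splits)
qed auto

text \<open>Machines start in state \<open>0\<close>, so an arbitrary numbering is composed with the
  transposition of \<open>0\<close> and the number of \<open>a\<close>.\<close>

lemma ex_numbering:
  assumes "finite S" "a \<in> S"
  obtains f where "bij_betw f S {..<card S}" "f a = (0::nat)"
proof -
  obtain g where g: "bij_betw g S {0..<card S}"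
    using ex_bij_betw_finite_nat[OF assms(1)] by blast
  let ?t = "\<lambda>i. if i = g a then 0 else if i = 0 then g a else i"
  have ga: "g a < card S" using g assms(2) by (auto simp: bij_betw_def)
  have "bij_betw ?t {0..<card S} {..<card S}"
    by (rule bij_betwI[where g = ?t]) (use ga in auto)
  then have "bij_betw (?t \<circ> g) S {..<card S}" using g by (rule bij_betw_trans[rotated])
  then show ?thesis by (rule that) simp
qed

theorem ex_turing_machine:
  assumes "0 < k"
  shows "\<exists>M. wf_turing_machine M \<and> tapes M = k \<and>
    (\<forall>T s s'. runs k p T s s' \<longrightarrow>
      (tm_step M ^^ T) (0, map s [0..<k]) = (states M, map s' [0..<k]))"
proof -
  define S where "S = conts p []"
  have fin: "finite S" and pS: "[p] \<in> S" and nS: "[] \<notin> S"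
    and closed: "\<And>C r. C \<in> S \<Longrightarrow> fst (next_cont C r) \<in> insert [] S"
    unfolding S_def by (rule finite_conts Cons_in_conts Nil_notin_conts next_cont_in_conts; assumption?)+
  obtain f where f: "bij_betw f S {..<card S}" "f [p] = 0"
    using ex_numbering[OF fin pS] .
  \<comment> \<open>The empty continuation lies outside \<open>S\<close> and gets the first free
    number, which is the halting state.\<close>
  define num where "num C = (if C = [] then card S else f C)" for C
  have num_less: "num C < card S" if "C \<in> S" for C
    using that f nS by (auto simp: num_def bij_betw_def)
  have num_le: "num C \<le> card S" if "C \<in> insert [] S" for C
    using that num_less[of C] by (auto simp: num_def less_imp_le)
  have inv_num: "inv_into S f (num C) = C" if "C \<in> S" for C
    using that f(1) nS by (auto simp: num_def bij_betw_def)
  define rd where "rd xs = (\<lambda>i. if i < k then xs ! i else None)" for xs :: "bool option list"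
  define M where "M = \<lparr>tapes = k, states = card S,
    trans = \<lambda>q xs. (let y = next_cont (inv_into S f q) (rd xs)
      in (num (fst y), map (snd y) [0..<k]))\<rparr>"
  have wf: "wf_turing_machine M"
    unfolding wf_turing_machine_def
  proof (intro conjI allI impI)
    show "0 < tapes M" using assms by (simp add: M_def)
    fix q xs assume q: "q < states M"
    then have "inv_into S f q \<in> S"
      using f(1) by (intro inv_into_into) (auto simp: M_def bij_betw_def)
    then show "fst (trans M q xs) \<le> states M"
      using num_le[OF closed] by (simp add: M_def Let_def)
    show "length (snd (trans M q xs)) = tapes M" by (simp add: M_def Let_def)
  qed
  have step: "tm_step M (num C, map s [0..<k]) =
      (num (fst (exec k (C, s))), map (snd (exec k (C, s))) [0..<k])" if "C \<in> insert [] S" for C s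
  proof (cases "C = []")
    case True
    then show ?thesis by (simp add: exec_def num_def M_def)
  next
    case False
    with that have C: "C \<in> S" by simp
    have rd: "rd (map tape_read (map s [0..<k])) = reads k s"
      by (auto simp: rd_def reads_def)
    show ?thesis
      using num_less[OF C] inv_num[OF C]
      by (simp add: M_def Let_def rd[unfolded map_map] exec_def act_all_def)
        (auto intro!: nth_equalityI)
  qed
  have steps: "fst ((exec k ^^ t) ([p], s)) \<in> insert [] S \<and> (tm_step M ^^ t) (0, map s [0..<k]) =
      (num (fst ((exec k ^^ t) ([p], s))), map (snd ((exec k ^^ t) ([p], s))) [0..<k])" for t s
  proof (induction t)
    case 0
    then show ?case using pS f(2) by (simp add: num_def)
  next
    case (Suc t)
    obtain C u where Cu: "(exec k ^^ t) ([p], s) = (C, u)" by fastforce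
    have "C \<in> insert [] S" using Suc Cu by simp
    then have "fst (exec k (C, u)) \<in> insert [] S"
      using closed by (cases "C = []") (auto simp: exec_def)
    then show ?case using Suc Cu step[OF \<open>C \<in> insert [] S\<close>, of u] by simp
  qed
  have "(tm_step M ^^ T) (0, map s [0..<k]) = (states M, map s' [0..<k])"
    if "runs k p T s s'" for T s s'
  proof -
    obtain t where t: "t \<le> T" "(exec k ^^ t) ([p], s) = ([], s')"
      by (rule runsE[OF \<open>runs k p T s s'\<close>]) (rule that)
    \<comment> \<open>The empty continuation is a fixed point, so a run that ends before time
      \<open>T\<close> still shows its result at time \<open>T\<close>.\<close>
    have "(exec k ^^ u) ([], s') = ([], s')" for u
      by (induction u) (auto simp: exec_def)
    with t have "(exec k ^^ T) ([p], s) = ([], s')"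
      using exec_trans[OF t(2), of "T - t"] by simp
    with steps[of T s] show ?thesis by (simp add: num_def M_def)
  qed
  then show ?thesis using wf by (intro exI[of _ M]) (simp add: M_def)
qed

section \<open>Printing the table of a quantifier-free formula\<close>

definition shift :: "(nat \<Rightarrow> move) \<Rightarrow> prog" where
  "shift d = Act (\<lambda>r i. (r i, d i))"

text \<open>
  The \<open>k\<close> tapes are the input \<open>0\<close>, the output \<open>k - 1\<close>, and unary tapes in between, which contain
  \<open>n\<close> marks and on which a number is represented by the head position. The idle value of a unary
  tape is \<open>-1\<close>, except for tape \<open>3\<close>, where it is \<open>n - 1\<close>; tapes \<open>1\<close> and \<open>2\<close> are scratch space, and tape
  \<open>4 + i\<close> holds the \<open>i\<close>-th variable.
\<close>

definition emit :: "nat \<Rightarrow> bool \<Rightarrow> prog" where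
  "emit k b = Act (\<lambda>r i. if i = k - 1 then (Some b, MoveRight) else (r i, Stay))"

text \<open>The left end of the input is recognised by the blank before it: the head overshoots to
  position \<open>-1\<close> and steps back.\<close>

definition rewind :: prog where
  "rewind = Seq (While (\<lambda>r. r 0 \<noteq> None) (shift ((\<lambda>_. Stay)(0 := MoveLeft))))
     (shift ((\<lambda>_. Stay)(0 := MoveRight)))"

text \<open>
  Runs \<open>b\<close> once more than the value of tape \<open>i\<close> says, which is then restored from the scratch tape \<open>a\<close>.
\<close>

definition repeat :: "nat \<Rightarrow> nat \<Rightarrow> prog \<Rightarrow> prog" where
  "repeat i a b =
     Seq (While (\<lambda>r. r i = Some True) (Seq (shift ((\<lambda>_. Stay)(i := MoveLeft, a := MoveRight))) b))
       (While (\<lambda>r. r a = Some True) (shift ((\<lambda>_. Stay)(a := MoveLeft, i := MoveRight))))"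

text \<open>The idle position \<open>-1\<close> is the blank before the marks, so one move gives the
  value 0. After the last round the head is on the blank at \<open>n\<close>, hence the single step
  back before the walk over the marks to \<open>-1\<close>.\<close>

definition for_all :: "nat \<Rightarrow> prog \<Rightarrow> prog" where
  "for_all i b = Seq (shift ((\<lambda>_. Stay)(i := MoveRight)))
     (Seq (While (\<lambda>r. r i = Some True) (Seq b (shift ((\<lambda>_. Stay)(i := MoveRight)))))
       (Seq (shift ((\<lambda>_. Stay)(i := MoveLeft)))
         (While (\<lambda>r. r i = Some True) (shift ((\<lambda>_. Stay)(i := MoveLeft))))))"

fun for_tuples :: "nat \<Rightarrow> nat \<Rightarrow> prog \<Rightarrow> prog" where
  "for_tuples i 0 b = b"
| "for_tuples i (Suc e) b = for_all i (for_tuples (Suc i) e b)"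

datatype formula =
    Verum
  | Less nat nat
  | Edge nat nat
  | Neg formula
  | Conj formula formula

fun holds :: "(nat \<Rightarrow> nat \<Rightarrow> bool) \<Rightarrow> nat list \<Rightarrow> formula \<Rightarrow> bool" where
  "holds E t Verum \<longleftrightarrow> True"
| "holds E t (Less i j) \<longleftrightarrow> t ! i < t ! j"
| "holds E t (Edge i j) \<longleftrightarrow> E (t ! i) (t ! j)"
| "holds E t (Neg \<phi>) \<longleftrightarrow> \<not> holds E t \<phi>"
| "holds E t (Conj \<phi> \<psi>) \<longleftrightarrow> holds E t \<phi> \<and> holds E t \<psi>"

fun wf_formula :: "nat \<Rightarrow> formula \<Rightarrow> bool" where
  "wf_formula e Verum \<longleftrightarrow> True"
| "wf_formula e (Less i j) \<longleftrightarrow> i < e \<and> j < e \<and> i \<noteq> j"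
| "wf_formula e (Edge i j) \<longleftrightarrow> i < e \<and> j < e"
| "wf_formula e (Neg \<phi>) \<longleftrightarrow> wf_formula e \<phi>"
| "wf_formula e (Conj \<phi> \<psi>) \<longleftrightarrow> wf_formula e \<phi> \<and> wf_formula e \<psi>"

text \<open>Both heads count down together while tape \<open>1\<close> counts the rounds. The
  smaller number leaves its marks first, and equal numbers leave together. The heads are restored
  inside the branches because restoring erases the outcome of the comparison.\<close>

definition test_less :: "nat \<Rightarrow> nat \<Rightarrow> prog \<Rightarrow> prog \<Rightarrow> prog" where
  "test_less i j P Q =
     (let restore = While (\<lambda>r. r 1 = Some True)
        (shift ((\<lambda>_. Stay)(1 := MoveLeft, i := MoveRight, j := MoveRight)))
      in Seq (While (\<lambda>r. r i = Some True \<and> r j = Some True)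
          (shift ((\<lambda>_. Stay)(1 := MoveRight, i := MoveLeft, j := MoveLeft))))
        (If (\<lambda>r. r i = None \<and> r j = Some True) (Seq restore P) (Seq restore Q)))"

text \<open>
  The entry \<open>(a, b)\<close> of the adjacency matrix is at position \<open>n + 1 + a n + b = (a + 1) n + (b + 1)\<close> of
  the input, and \<open>a + 1\<close> and \<open>b + 1\<close> are just the numbers of rounds made by \<open>repeat\<close>.
\<close>

definition test_edge :: "nat \<Rightarrow> nat \<Rightarrow> prog \<Rightarrow> prog \<Rightarrow> prog" where
  "test_edge i j P Q =
     (let right = shift ((\<lambda>_. Stay)(0 := MoveRight))
      in Seq (repeat i 1 (repeat 3 2 right)) (Seq (repeat j 1 right)
        (If (\<lambda>r. r 0 = Some True) (Seq rewind P) (Seq rewind Q))))"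

text \<open>The two outcomes are programs to continue with, so no truth value is ever stored on a
  tape: negation exchanges them, and a conjunction tests its second part only after the first has
  succeeded.\<close>

fun test :: "formula \<Rightarrow> prog \<Rightarrow> prog \<Rightarrow> prog" where
  "test Verum P Q = P"
| "test (Less i j) P Q = test_less (4 + i) (4 + j) P Q"
| "test (Edge i j) P Q = test_edge (4 + i) (4 + j) P Q"
| "test (Neg \<phi>) P Q = test \<phi> Q P"
| "test (Conj \<phi> \<psi>) P Q = test \<phi> (test \<psi> P Q) Q"

text \<open>The unary prefix of the input is the source of \<open>n\<close>: each of its marks is
  copied to all unary tapes, up to the delimiter. Afterwards all unary heads are moved back by one,
  which is the idle position of tape \<open>3\<close>, and the others go on to \<open>-1\<close>;
  tape \<open>1\<close> decides for all of them when to stop.\<close>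

definition prepare :: "nat \<Rightarrow> prog" where
  "prepare k =
     Seq (While (\<lambda>r. r 0 = Some True) (Act (\<lambda>r i. if i = 0 then (r i, MoveRight)
         else if i < k - 1 then (Some True, MoveRight) else (r i, Stay))))
       (Seq (shift (\<lambda>i. if 0 < i \<and> i < k - 1 then MoveLeft else Stay))
         (Seq (While (\<lambda>r. r 1 = Some True)
             (shift (\<lambda>i. if 0 < i \<and> i \<noteq> 3 \<and> i < k - 1 then MoveLeft else Stay)))
           rewind))"

fun emit_all :: "nat \<Rightarrow> (nat \<times> formula) list \<Rightarrow> prog" where
  "emit_all k [] = shift (\<lambda>_. Stay)"
| "emit_all k ((e, \<phi>) # bs) =
     Seq (for_tuples 4 e (test \<phi> (emit k True) (emit k False))) (emit_all k bs)"

section \<open>Time bounds\<close>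

definition repeat_cost :: "nat \<Rightarrow> nat \<Rightarrow> nat" where
  "repeat_cost L T = L * (T + 5) + 3"

text \<open>\<open>L\<close> is the length of the input, a bound for \<open>n\<close> and thus for
  every loop count. The cost of the program that continues after the test is not included.\<close>

fun test_cost :: "nat \<Rightarrow> formula \<Rightarrow> nat" where
  "test_cost L Verum = 0"
| "test_cost L (Less i j) = 4 * L + 5"
| "test_cost L (Edge i j) = repeat_cost L (repeat_cost L 1) + repeat_cost L 1 + 2 * L + 7"
| "test_cost L (Neg \<phi>) = test_cost L \<phi>"
| "test_cost L (Conj \<phi> \<psi>) = test_cost L \<phi> + test_cost L \<psi>"

fun for_tuples_cost :: "nat \<Rightarrow> nat \<Rightarrow> nat \<Rightarrow> nat" where
  "for_tuples_cost L 0 T = T"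
| "for_tuples_cost L (Suc e) T = L * (for_tuples_cost L e T + 5) + 7"

fun emit_all_cost :: "nat \<Rightarrow> (nat \<times> formula) list \<Rightarrow> nat" where
  "emit_all_cost L [] = 1"
| "emit_all_cost L ((e, \<phi>) # bs) =
     for_tuples_cost L e (test_cost L \<phi> + 1) + emit_all_cost L bs + 1"

definition formula_table :: "(nat \<Rightarrow> nat \<Rightarrow> bool) \<Rightarrow> nat \<Rightarrow> nat \<times> formula \<Rightarrow> bool list" where
  "formula_table E n = (\<lambda>(e, \<phi>). map (\<lambda>t. holds E t \<phi>) (product_lists (replicate e [0..<n])))"

section \<open>Correctness and running time of the programs\<close>

lemma concat_map_concat: "concat (map (\<lambda>a. concat (h a)) xs) = concat (concat (map h xs))"
  by (induction xs) auto

text \<open>In the locale, \<open>w\<close> is the encoding of a digraph on \<open>{..<n}\<close> with edge relation \<open>E\<close>.\<close>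

locale head_machine =
  fixes k :: nat and w :: "bool list" and n :: nat and E :: "nat \<Rightarrow> nat \<Rightarrow> bool"
  assumes k: "5 \<le> k"
    and length_w: "length w = n * n + n + 1"
    and w_prefix: "\<And>i. i < n \<Longrightarrow> w ! i" "\<not> w ! n"
    and w_matrix: "\<And>a b. a < n \<Longrightarrow> b < n \<Longrightarrow> w ! ((a + 1) * n + b + 1) = E a b"
begin

text \<open>Apart from the output, only head positions change once the unary tapes are filled, so a
  state is given by the positions \<open>x\<close> and the output \<open>v\<close>. The number
  \<open>m\<close> of marks is a parameter for the sake of the filling phase.\<close>

definition conf :: "nat \<Rightarrow> (nat \<Rightarrow> int) \<Rightarrow> bool list \<Rightarrow> nat \<Rightarrow> tape" where
  "conf m x v = (\<lambda>i. if i = 0 then (word_contents w, x 0)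
     else if i < k - 1 then (word_contents (replicate m True), x i)
     else if i = k - 1 then (word_contents v, int (length v))
     else (word_contents [], 0))"

lemma reads_conf:
  "0 < i \<Longrightarrow> i < k - 1 \<Longrightarrow>
    reads k (conf m x v) i = (if 0 \<le> x i \<and> x i < int m then Some True else None)"
  by (auto simp: reads_def conf_def word_contents_def)

lemma reads_conf_0: "reads k (conf m x v) 0 = word_contents w (x 0)"
  using k by (simp add: reads_def conf_def)

lemma conf_cong: "(\<And>i. i < k - 1 \<Longrightarrow> x i = x' i) \<Longrightarrow> conf m x v = conf m x' v"
  using k by (force simp: conf_def)

lemma act_all_shift:
  assumes "\<And>i. k - 1 \<le> i \<Longrightarrow> d i = Stay" "\<And>i. i < k - 1 \<Longrightarrow> x' i = x i + displacement (d i)"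
  shows "act_all k (\<lambda>i. (reads k (conf m x v) i, d i)) (conf m x v) = conf m x' v"
  using assms k by (auto simp: act_all_def reads_def conf_def fun_eq_iff)

lemma runs_shift:
  assumes "\<And>i. k - 1 \<le> i \<Longrightarrow> d i = Stay" "\<And>i. i < k - 1 \<Longrightarrow> x' i = x i + displacement (d i)"
  shows "runs k (shift d) 1 (conf m x v) (conf m x' v)"
  unfolding shift_def by (rule runs_Act) (rule act_all_shift[OF assms])

text \<open>Positions are affine in the number of rounds, so the count \<open>y\<close> determines
  the whole loop. A round is one step for the condition and one for the move.\<close>

lemma runs_While_shift:
  assumes "\<And>i. k - 1 \<le> i \<Longrightarrow> d i = Stay"
    and "\<And>j. j < y \<Longrightarrow> c (reads k (conf m (\<lambda>i. x i + int j * displacement (d i)) v))"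
    and "\<not> c (reads k (conf m (\<lambda>i. x i + int y * displacement (d i)) v))"
    and "\<And>i. i < k - 1 \<Longrightarrow> x' i = x i + int y * displacement (d i)"
  shows "runs k (While c (shift d)) (2 * y + 1) (conf m x v) (conf m x' v)"
proof -
  let ?S = "\<lambda>j. conf m (\<lambda>i. x i + int j * displacement (d i)) v"
  have "runs k (While c (shift d)) (2 * y + 1) (?S 0) (?S y)"
    by (rule runs_While[where T = 1], rule assms(2), assumption, rule runs_shift)
      (use assms in \<open>auto simp: algebra_simps\<close>)
  moreover have "?S y = conf m x' v" by (rule conf_cong) (simp add: assms(4))
  ultimately show ?thesis by simp
qed

lemma runs_emit: "runs k (emit k b) 1 (conf m x v) (conf m x (v @ [b]))"
  unfolding emit_def
  by (rule runs_Act)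
    (use k in \<open>auto simp: act_all_def reads_def conf_def fun_eq_iff word_contents_def nth_append\<close>)

lemma runs_rewind:
  assumes "x 0 = int p" "p < length w"
  shows "runs k rewind (2 * p + 5) (conf m x v) (conf m (x(0 := 0)) v)"
  unfolding rewind_def
  \<comment> \<open>From \<open>p\<close> down to \<open>0\<close> and on to the blank at
    \<open>-1\<close> takes \<open>p + 1\<close> rounds.\<close>
  by (rule runs_Seq[OF runs_While_shift[where y = "p + 1" and x' = "x(0 := -1)"] runs_shift])
    (use assms k in \<open>auto simp: reads_conf_0 word_contents_def\<close>)

text \<open>The body must work wherever the heads \<open>0\<close>, \<open>i\<close> and
  \<open>a\<close> stand, as these move during the loop. A round costs \<open>T + 3\<close> on the
  way down (condition, sequencing, shift, body) and 2 when the heads are restored.\<close>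

lemma runs_repeat:
  assumes "0 < i" "i < k - 1" "0 < a" "a < k - 1" "i \<noteq> a" "x i = int y - 1" "y \<le> n" "x a = -1"
    and body: "\<And>x'. (\<And>j. j \<notin> {0, i, a} \<Longrightarrow> x' j = x j) \<Longrightarrow>
      runs k b T (conf n x' v) (conf n (x'(0 := x' 0 + c)) v)"
  shows "runs k (repeat i a b) (y * (T + 5) + 3) (conf n x v) (conf n (x(0 := x 0 + int y * c)) v)"
proof -
  let ?S = "\<lambda>j. conf n (x(i := int y - 1 - int j, a := int j - 1, 0 := x 0 + int j * c)) v"
  let ?U = "\<lambda>j. conf n (x(i := int y - 1 - Suc j, a := int (Suc j) - 1, 0 := x 0 + int j * c)) v"
  let ?c = "\<lambda>r. r i = Some True"
  let ?b = "Seq (shift ((\<lambda>_. Stay)(i := MoveLeft, a := MoveRight))) b"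
  have step: "runs k ?b (T + 2) (?S j) (?S (Suc j))" for j
  proof (rule runs_Seq)
    show "runs k (shift ((\<lambda>_. Stay)(i := MoveLeft, a := MoveRight))) 1 (?S j) (?U j)"
      by (rule runs_shift) (use assms(1-5) in auto)
    show "runs k b T (?U j) (?S (Suc j))"
      using body[of "x(i := int y - 1 - Suc j, a := int (Suc j) - 1, 0 := x 0 + int j * c)"]
      by (simp add: algebra_simps)
  qed simp
  have "runs k (While ?c ?b) (y * (T + 3) + 1) (?S 0) (?S y)"
  proof (rule runs_While[where T = "T + 2"])
    fix j assume "j < y"
    then show "reads k (?S j) i = Some True" using assms(1-8) by (auto simp: reads_conf)
    show "runs k ?b (T + 2) (?S j) (?S (Suc j))" by (rule step)
  next
    show "reads k (?S y) i \<noteq> Some True" using assms(1-8) by (auto simp: reads_conf)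
  qed (simp add: algebra_simps)
  moreover have "?S 0 = conf n x v"
    by (rule conf_cong) (use assms(1-8) in auto)
  moreover have "runs k (While (\<lambda>r. r a = Some True)
      (shift ((\<lambda>_. Stay)(a := MoveLeft, i := MoveRight)))) (2 * y + 1)
      (?S y) (conf n (x(0 := x 0 + int y * c)) v)"
    by (rule runs_While_shift) (use assms(1-8) in \<open>auto simp: reads_conf\<close>)
  ultimately show ?thesis
    unfolding repeat_def by (intro runs_Seq) (auto simp: algebra_simps)
qed

lemma runs_test_less:
  assumes ij: "3 < i" "i < k - 1" "3 < j" "j < k - 1" "i \<noteq> j"
    and x: "x i = int a" "x j = int b" "a < n" "b < n" "x 1 = -1"
    and P: "a < b \<Longrightarrow> runs k P U (conf n x v) s'"
    and Q: "\<not> a < b \<Longrightarrow> runs k Q U (conf n x v) s'"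
  shows "runs k (test_less i j P Q) (4 * length w + 5 + U) (conf n x v) s'"
proof -
  \<comment> \<open>The number of rounds after which the head of the smaller value is at
    \<open>-1\<close>; tape \<open>1\<close> has then moved from \<open>-1\<close> to
    \<open>m - 1\<close>.\<close>
  define m where "m = min a b + 1"
  let ?x = "x(i := int a - int m, j := int b - int m, 1 := int m - 1)"
  let ?restore = "While (\<lambda>r. r 1 = Some True)
    (shift ((\<lambda>_. Stay)(1 := MoveLeft, i := MoveRight, j := MoveRight)))"
  have down: "runs k (While (\<lambda>r. r i = Some True \<and> r j = Some True)
      (shift ((\<lambda>_. Stay)(1 := MoveRight, i := MoveLeft, j := MoveLeft)))) (2 * m + 1)
      (conf n x v) (conf n ?x v)"
    by (rule runs_While_shift) (use ij x in \<open>auto simp: reads_conf m_def\<close>)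
  have up: "runs k ?restore (2 * m + 1) (conf n ?x v) (conf n x v)"
    by (rule runs_While_shift) (use ij x in \<open>auto simp: reads_conf m_def\<close>)
  have "m \<le> length w" using x length_w by (auto simp: m_def)
  have "runs k (If (\<lambda>r. r i = None \<and> r j = Some True) (Seq ?restore P) (Seq ?restore Q))
      (2 * m + 3 + U) (conf n ?x v) s'"
  proof (rule runs_If)
    assume "reads k (conf n ?x v) i = None \<and> reads k (conf n ?x v) j = Some True"
    then have "a < b" using ij x by (auto simp: reads_conf m_def split: if_splits)
    then show "runs k (Seq ?restore P) (2 * m + 2 + U) (conf n ?x v) s'"
      by (intro runs_Seq[OF up P]) auto
  next
    assume "\<not> (reads k (conf n ?x v) i = None \<and> reads k (conf n ?x v) j = Some True)"
    then have "\<not> a < b" using ij x by (auto simp: reads_conf m_def split: if_splits)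
    then show "runs k (Seq ?restore Q) (2 * m + 2 + U) (conf n ?x v) s'"
      by (intro runs_Seq[OF up Q]) auto
  qed simp
  then show ?thesis
    unfolding test_less_def Let_def
    by (rule runs_Seq[OF down]) (use \<open>m \<le> length w\<close> in simp)
qed

lemma repeat_cost_mono: "y \<le> L \<Longrightarrow> T \<le> U \<Longrightarrow> y * (T + 5) + 3 \<le> repeat_cost L U"
  unfolding repeat_cost_def by (intro add_mono mult_mono) auto

lemma runs_test_edge:
  assumes ij: "3 < i" "i < k - 1" "3 < j" "j < k - 1"
    and x: "x i = int a" "x j = int b" "a < n" "b < n" "x 0 = 0" "x 1 = -1" "x 2 = -1"
      "x 3 = int n - 1"
    and P: "E a b \<Longrightarrow> runs k P U (conf n x v) s'"
    and Q: "\<not> E a b \<Longrightarrow> runs k Q U (conf n x v) s'"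
  shows "runs k (test_edge i j P Q) (test_cost (length w) (Edge i' j') + U) (conf n x v) s'"
proof -
  let ?L = "length w"
  let ?right = "shift ((\<lambda>_. Stay)(0 := MoveRight))"
  have nL: "n \<le> ?L" using length_w by simp
  have right: "runs k ?right 1 (conf n y v) (conf n (y(0 := y 0 + 1)) v)" for y
    by (rule runs_shift) (use k in auto)
  \<comment> \<open>Tape \<open>3\<close> idles at \<open>n - 1\<close>, so there are exactly
    \<open>n\<close> rounds, the length of one row of the matrix.\<close>
  have row: "runs k (repeat 3 2 ?right) (repeat_cost ?L 1) (conf n y v)
      (conf n (y(0 := y 0 + int n)) v)"
    if "y 2 = -1" "y 3 = int n - 1" for y
    using runs_repeat[of 3 2 y n ?right 1 v 1] that k ij right
    by (intro runs_mono[OF _ repeat_cost_mono[OF nL order_refl]]) auto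
  let ?x = "x(0 := int (a + 1) * int n)"
  have rows: "runs k (repeat i 1 (repeat 3 2 ?right)) (repeat_cost ?L (repeat_cost ?L 1))
      (conf n x v) (conf n ?x v)"
    using runs_repeat[of i 1 x "a + 1" "repeat 3 2 ?right" "repeat_cost ?L 1" v "int n"] x k ij row nL
    by (intro runs_mono[OF _ repeat_cost_mono[of "a + 1", OF _ order_refl]]) auto
  define p where "p = (a + 1) * n + b + 1"
  \<comment> \<open>As a + 1 \<le> n and b < n, the position is at most \<open>n * n + n\<close>,
    the last one of the word.\<close>
  have "(a + 1) * n \<le> n * n" using x by (intro mult_right_mono) auto
  then have p: "p < ?L" using x length_w by (simp add: p_def)
  have cols: "runs k (repeat j 1 ?right) (repeat_cost ?L 1) (conf n ?x v) (conf n (x(0 := int p)) v)"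
    using runs_repeat[of j 1 ?x "b + 1" ?right 1 v 1] x k ij right nL
    by (intro runs_mono[OF _ repeat_cost_mono[of "b + 1", OF _ order_refl]])
      (auto simp: p_def algebra_simps)
  have return: "runs k rewind (2 * p + 5) (conf n (x(0 := int p)) v) (conf n x v)"
  proof -
    have "x(0 := 0) = x" using x by auto
    then show ?thesis using runs_rewind[of "x(0 := int p)" p n v] p by simp
  qed
  have "w ! p = E a b" unfolding p_def using x by (intro w_matrix)
  then have "reads k (conf n (x(0 := int p)) v) 0 = Some (E a b)"
    using p by (simp add: reads_conf_0 word_contents_def)
  then have "runs k (If (\<lambda>r. r 0 = Some True) (Seq rewind P) (Seq rewind Q)) (2 * p + 7 + U)
      (conf n (x(0 := int p)) v) s'"
    by (intro runs_If[where T = "2 * p + 6 + U"] runs_Seq[where U = U, OF return] P Q) auto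
  then have branch: "runs k (If (\<lambda>r. r 0 = Some True) (Seq rewind P) (Seq rewind Q)) (2 * ?L + 5 + U)
      (conf n (x(0 := int p)) v) s'"
    by (rule runs_mono) (use p in simp)
  show ?thesis
    unfolding test_edge_def Let_def
    by (rule runs_Seq[OF rows runs_Seq[OF cols branch order_refl]]) simp
qed

definition idle :: "nat list \<Rightarrow> (nat \<Rightarrow> int) \<Rightarrow> bool" where
  "idle t x \<longleftrightarrow> x 0 = 0 \<and> x 1 = -1 \<and> x 2 = -1 \<and> x 3 = int n - 1 \<and>
     (\<forall>i<length t. x (4 + i) = int (t ! i) \<and> t ! i < n) \<and> length t + 4 < k"

text \<open>The programs \<open>P\<close> and \<open>Q\<close> and their budget \<open>U\<close>
  must vary in the induction: in a conjunction the first test continues with the second, whose cost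
  joins the budget.\<close>

lemma runs_test:
  assumes "idle t x" "wf_formula (length t) \<phi>"
    and "holds E t \<phi> \<Longrightarrow> runs k P U (conf n x v) s'"
    and "\<not> holds E t \<phi> \<Longrightarrow> runs k Q U (conf n x v) s'"
  shows "runs k (test \<phi> P Q) (test_cost (length w) \<phi> + U) (conf n x v) s'"
  using assms(2-)
proof (induction \<phi> arbitrary: P Q U)
  case (Less i j)
  then show ?case
    using assms(1) runs_test_less[of "4 + i" "4 + j" x "t ! i" "t ! j" P U v s' Q]
    by (auto simp: idle_def)
next
  case (Edge i j)
  then show ?case
    using assms(1) runs_test_edge[of "4 + i" "4 + j" x "t ! i" "t ! j" P U v s' Q i j]
    by (auto simp: idle_def)
next
  case (Conj \<phi> \<psi>)
  have inner: "runs k (test \<psi> P Q) (test_cost (length w) \<psi> + U) (conf n x v) s'"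
    if "holds E t \<phi>"
  proof (rule Conj.IH(2))
    show "wf_formula (length t) \<psi>" using Conj.prems(1) by simp
    show "runs k P U (conf n x v) s'" if "holds E t \<psi>"
      by (rule Conj.prems(2)) (simp add: that \<open>holds E t \<phi>\<close>)
    show "runs k Q U (conf n x v) s'" if "\<not> holds E t \<psi>"
      by (rule Conj.prems(3)) (simp add: that)
  qed
  have "runs k (test \<phi> (test \<psi> P Q) Q) (test_cost (length w) \<phi> + (test_cost (length w) \<psi> + U))
      (conf n x v) s'"
  proof (rule Conj.IH(1)[OF _ inner])
    show "wf_formula (length t) \<phi>" using Conj.prems(1) by simp
    show "runs k Q (test_cost (length w) \<psi> + U) (conf n x v) s'" if "\<not> holds E t \<phi>"
      by (rule runs_mono[OF Conj.prems(3)]) (simp_all add: that)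
  qed
  then show ?case by (simp add: add.assoc)
qed auto

text \<open>The constant 7 consists of two shifts, the two final evaluations of loop conditions, and
  three sequencings.\<close>

lemma runs_for_all:
  assumes i: "0 < i" "i < k - 1" "x i = -1"
    and body: "\<And>a v. a < n \<Longrightarrow>
      runs k b T (conf n (x(i := int a)) v) (conf n (x(i := int a)) (v @ g a))"
  shows "runs k (for_all i b) (length w * (T + 5) + 7)
    (conf n x v) (conf n x (v @ concat (map g [0..<n])))"
proof -
  let ?S = "\<lambda>j. conf n (x(i := int j)) (v @ concat (map g [0..<j]))"
  let ?v = "v @ concat (map g [0..<n])"
  have step: "runs k (Seq b (shift ((\<lambda>_. Stay)(i := MoveRight)))) (T + 2) (?S j) (?S (Suc j))"
    if "j < n" for j
  proof (rule runs_Seq)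
    show "runs k b T (?S j) (conf n (x(i := int j)) (v @ concat (map g [0..<Suc j])))"
      using body[OF that, of "v @ concat (map g [0..<j])"] by simp
    show "runs k (shift ((\<lambda>_. Stay)(i := MoveRight))) 1
        (conf n (x(i := int j)) (v @ concat (map g [0..<Suc j]))) (?S (Suc j))"
      by (rule runs_shift) (use i in auto)
  qed simp
  have 1: "runs k (shift ((\<lambda>_. Stay)(i := MoveRight))) 1 (conf n x v) (?S 0)"
  proof -
    have "?S 0 = conf n (x(i := 0)) v" by simp
    then show ?thesis by (simp only:) (rule runs_shift; use i in auto)
  qed
  have 2: "runs k (While (\<lambda>r. r i = Some True) (Seq b (shift ((\<lambda>_. Stay)(i := MoveRight)))))
      (n * (T + 3) + 1) (?S 0) (?S n)"
    by (rule runs_While[where S = ?S, OF _ step]) (use i in \<open>auto simp: reads_conf algebra_simps\<close>)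
  have 3: "runs k (shift ((\<lambda>_. Stay)(i := MoveLeft))) 1 (?S n) (conf n (x(i := int n - 1)) ?v)"
    by (rule runs_shift) (use i in auto)
  have 4: "runs k (While (\<lambda>r. r i = Some True) (shift ((\<lambda>_. Stay)(i := MoveLeft)))) (2 * n + 1)
      (conf n (x(i := int n - 1)) ?v) (conf n x ?v)"
    by (rule runs_While_shift) (use i in \<open>auto simp: reads_conf\<close>)
  have "n * (T + 5) \<le> length w * (T + 5)" using length_w by (intro mult_right_mono) auto
  then show ?thesis
    unfolding for_all_def
    by (intro runs_Seq[OF 1 runs_Seq[OF 2 runs_Seq[OF 3 4 order_refl] order_refl]])
      (simp add: algebra_simps)
qed

fun set_heads :: "nat \<Rightarrow> nat list \<Rightarrow> (nat \<Rightarrow> int) \<Rightarrow> nat \<Rightarrow> int" where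
  "set_heads i [] x = x"
| "set_heads i (a # t) x = set_heads (Suc i) t (x(i := int a))"

lemma set_heads_apply:
  "set_heads i t x j = (if i \<le> j \<and> j < i + length t then int (t ! (j - i)) else x j)"
  by (induction t arbitrary: i x) (auto simp: nth_Cons')

lemma runs_for_tuples:
  assumes "0 < i" "i + e \<le> k - 1" "\<And>j. i \<le> j \<Longrightarrow> j < i + e \<Longrightarrow> x j = -1"
    and "\<And>t v. t \<in> set (product_lists (replicate e [0..<n])) \<Longrightarrow>
      runs k b T (conf n (set_heads i t x) v) (conf n (set_heads i t x) (v @ g t))"
  shows "runs k (for_tuples i e b) (for_tuples_cost (length w) e T) (conf n x v)
    (conf n x (v @ concat (map g (product_lists (replicate e [0..<n])))))"
  using assms
proof (induction e arbitrary: i x g v)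
  case (Suc e)
  have "runs k (for_tuples (Suc i) e b) (for_tuples_cost (length w) e T) (conf n (x(i := int a)) v)
      (conf n (x(i := int a))
        (v @ concat (map (\<lambda>t. g (a # t)) (product_lists (replicate e [0..<n])))))"
    if "a < n" for a v
  proof (rule Suc.IH[of "Suc i" "x(i := int a)" "\<lambda>t. g (a # t)"])
    fix t v assume "t \<in> set (product_lists (replicate e [0..<n]))"
    then have "a # t \<in> set (product_lists (replicate (Suc e) [0..<n]))" using that by auto
    from Suc.prems(4)[OF this, of v] show "runs k b T (conf n (set_heads (Suc i) t (x(i := int a))) v)
        (conf n (set_heads (Suc i) t (x(i := int a))) (v @ g (a # t)))"
      by simp
  qed (use Suc.prems(1-3) in auto)
  then show ?case
    using runs_for_all[of i x "for_tuples (Suc i) e b" "for_tuples_cost (length w) e T"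
        "\<lambda>a. concat (map (\<lambda>t. g (a # t)) (product_lists (replicate e [0..<n])))" v] Suc.prems(1-3)
    by (simp add: map_concat comp_def concat_map_concat)
next
  case 0
  then show ?case using 0(4)[of "[]" v] by simp
qed

definition heads0 :: "nat \<Rightarrow> int" where
  "heads0 = (\<lambda>i. if i = 0 then 0 else if i = 3 then int n - 1 else -1)"

lemma runs_prepare:
  "runs k (prepare k) (length w * 6 + 14)
    (\<lambda>i. if i = 0 then (word_contents w, 0) else (word_contents [], 0)) (conf n heads0 [])"
proof -
  \<comment> \<open>While the tapes are being filled, the number of marks equals the head position.
    The start configuration of the machine is the case \<open>j = 0\<close>.\<close>
  let ?S = "\<lambda>j. conf j (\<lambda>_. int j) []"
  let ?x = "\<lambda>i::nat. if i = 0 then int n else int n - 1"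
  have nL: "n < length w" using length_w by simp
  have S0: "(\<lambda>i. if i = 0 then (word_contents w, 0) else (word_contents [], 0)) = ?S 0"
    by (auto simp: conf_def)
  have extend: "(word_contents (replicate j True))(int j := Some True) =
      word_contents (replicate (Suc j) True)" for j
    by (auto simp: word_contents_def fun_eq_iff simp del: replicate_Suc)
  have fill: "runs k (Act (\<lambda>r i. if i = 0 then (r i, MoveRight)
        else if i < k - 1 then (Some True, MoveRight) else (r i, Stay))) 1 (?S j) (?S (Suc j))" for j
    by (rule runs_Act)
      (use k extend in \<open>auto simp: act_all_def reads_def conf_def fun_eq_iff simp del: replicate_Suc\<close>)
  have 1: "runs k (While (\<lambda>r. r 0 = Some True) (Act (\<lambda>r i. if i = 0 then (r i, MoveRight)
        else if i < k - 1 then (Some True, MoveRight) else (r i, Stay)))) (2 * n + 1) (?S 0) (?S n)"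
    by (rule runs_While[where S = ?S, OF _ fill])
      (use nL w_prefix in \<open>auto simp: reads_conf_0 word_contents_def\<close>)
  have 2: "runs k (shift (\<lambda>i. if 0 < i \<and> i < k - 1 then MoveLeft else Stay)) 1 (?S n) (conf n ?x [])"
    by (rule runs_shift) auto
  have 3: "runs k (While (\<lambda>r. r 1 = Some True)
      (shift (\<lambda>i. if 0 < i \<and> i \<noteq> 3 \<and> i < k - 1 then MoveLeft else Stay))) (2 * n + 1)
      (conf n ?x []) (conf n (heads0(0 := int n)) [])"
    by (rule runs_While_shift) (use k in \<open>auto simp: reads_conf heads0_def\<close>)
  have 4: "runs k rewind (2 * n + 5) (conf n (heads0(0 := int n)) []) (conf n heads0 [])"
  proof -
    have "heads0(0 := 0) = heads0" by (auto simp: heads0_def)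
    then show ?thesis using runs_rewind[of "heads0(0 := int n)" n n "[]"] nL by simp
  qed
  show ?thesis
    unfolding prepare_def S0
    by (intro runs_Seq[OF 1 runs_Seq[OF 2 runs_Seq[OF 3 4 order_refl] order_refl]])
      (use nL in simp)
qed

lemma runs_emit_all:
  assumes "\<forall>(e, \<phi>)\<in>set bs. wf_formula e \<phi> \<and> e + 4 < k"
  shows "runs k (emit_all k bs) (emit_all_cost (length w) bs) (conf n heads0 v)
    (conf n heads0 (v @ concat (map (formula_table E n) bs)))"
  using assms
proof (induction bs arbitrary: v)
  case Nil
  then show ?case using runs_shift[of "\<lambda>_. Stay" heads0 heads0 n v] by simp
next
  case (Cons b bs)
  obtain e \<phi> where b: "b = (e, \<phi>)" by fastforce
  then have e: "wf_formula e \<phi>" "e + 4 < k" using Cons.prems by auto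
  have "runs k (test \<phi> (emit k True) (emit k False)) (test_cost (length w) \<phi> + 1)
      (conf n (set_heads 4 t heads0) v) (conf n (set_heads 4 t heads0) (v @ [holds E t \<phi>]))"
    if "t \<in> set (product_lists (replicate e [0..<n]))" for t v
  proof (rule runs_test)
    have "length t = e" "\<forall>i<e. t ! i < n"
      using that by (auto simp: product_lists_set list_all2_conv_all_nth)
    then show "idle t (set_heads 4 t heads0)" "wf_formula (length t) \<phi>"
      using e by (auto simp: idle_def set_heads_apply heads0_def)
  qed (metis runs_emit)+
  then have "runs k (for_tuples 4 e (test \<phi> (emit k True) (emit k False)))
      (for_tuples_cost (length w) e (test_cost (length w) \<phi> + 1)) (conf n heads0 v)
      (conf n heads0 (v @ formula_table E n b))"
    using runs_for_tuples[of 4 e heads0 "test \<phi> (emit k True) (emit k False)"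
        "test_cost (length w) \<phi> + 1" "\<lambda>t. [holds E t \<phi>]" v] e
    by (simp add: formula_table_def b heads0_def concat_map_singleton)
  from runs_Seq[OF this Cons.IH] Cons.prems show ?case by (simp add: b)
qed

lemma runs_prepare_emit_all:
  assumes "\<forall>(e, \<phi>)\<in>set bs. wf_formula e \<phi> \<and> e + 4 < k"
  shows "runs k (Seq (prepare k) (emit_all k bs)) (length w * 6 + 15 + emit_all_cost (length w) bs)
    (\<lambda>i. if i = 0 then (word_contents w, 0) else (word_contents [], 0))
    (conf n heads0 (concat (map (formula_table E n) bs)))"
  using runs_Seq[OF runs_prepare runs_emit_all[OF assms, of "[]"] order_refl]
  by (simp add: add.assoc add.commute)

end

section \<open>Polynomial time, and the machine that prints tables\<close>

definition polynomial_fun :: "(nat \<Rightarrow> nat) \<Rightarrow> bool" where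
  "polynomial_fun f \<longleftrightarrow> (\<exists>p. \<forall>L. f L = poly p L)"

lemma polynomial_fun_const: "polynomial_fun (\<lambda>_. c)"
  unfolding polynomial_fun_def by (rule exI[of _ "[:c:]"]) simp

lemma polynomial_fun_id: "polynomial_fun (\<lambda>L. L)"
  unfolding polynomial_fun_def by (rule exI[of _ "[:0, 1:]"]) simp

lemma polynomial_fun_add: "polynomial_fun f \<Longrightarrow> polynomial_fun g \<Longrightarrow> polynomial_fun (\<lambda>L. f L + g L)"
  unfolding polynomial_fun_def by (metis poly_add)

lemma polynomial_fun_Suc: "polynomial_fun f \<Longrightarrow> polynomial_fun (\<lambda>L. Suc (f L))"
  using polynomial_fun_add[OF _ polynomial_fun_const, of f 1] by simp

lemma polynomial_fun_mult: "polynomial_fun f \<Longrightarrow> polynomial_fun g \<Longrightarrow> polynomial_fun (\<lambda>L. f L * g L)"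
  unfolding polynomial_fun_def by (metis poly_mult)

lemmas polynomial_fun_intros =
  polynomial_fun_const polynomial_fun_id polynomial_fun_Suc polynomial_fun_add polynomial_fun_mult

lemma polynomial_fun_test_cost: "polynomial_fun (\<lambda>L. test_cost L \<phi>)"
  by (induction \<phi>) (auto simp: repeat_cost_def intro!: polynomial_fun_intros)

lemma polynomial_fun_for_tuples_cost:
  "polynomial_fun f \<Longrightarrow> polynomial_fun (\<lambda>L. for_tuples_cost L e (f L))"
  by (induction e) (auto intro!: polynomial_fun_intros)

lemma polynomial_fun_emit_all_cost: "polynomial_fun (\<lambda>L. emit_all_cost L bs)"
proof (induction bs)
  case (Cons b bs)
  obtain e \<phi> where b: "b = (e, \<phi>)" by fastforce
  show ?case
    unfolding b emit_all_cost.simps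
    by (intro polynomial_fun_intros polynomial_fun_for_tuples_cost polynomial_fun_test_cost Cons.IH)
qed (auto intro: polynomial_fun_const)

theorem ex_formula_table_machine:
  assumes "\<forall>(e, \<phi>)\<in>set bs. wf_formula e \<phi>"
  shows "\<exists>M (p :: nat poly). wf_turing_machine M \<and>
    (\<forall>w n E. length w = n * n + n + 1 \<longrightarrow> (\<forall>i<n. w ! i) \<longrightarrow> \<not> w ! n \<longrightarrow>
      (\<forall>a<n. \<forall>b<n. w ! ((a + 1) * n + b + 1) = E a b) \<longrightarrow>
      tm_computes_within M (poly p (length w)) w (concat (map (formula_table E n) bs)))"
proof -
  \<comment> \<open>Five tapes are the input, two scratch tapes, tape \<open>3\<close> and the
    output; the sum of the arities is a crude bound for the number of variable tapes. It depends on
    \<open>bs\<close> alone, so one machine serves all inputs.\<close>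
  define k where "k = 5 + sum_list (map fst bs)"
  have k': "\<forall>(e, \<phi>)\<in>set bs. wf_formula e \<phi> \<and> e + 4 < k"
    using assms member_le_sum_list[of _ "map fst bs"] by (force simp: k_def)
  obtain M where M: "wf_turing_machine M" "tapes M = k"
    "\<And>T s s'. runs k (Seq (prepare k) (emit_all k bs)) T s s' \<Longrightarrow>
      (tm_step M ^^ T) (0, map s [0..<k]) = (states M, map s' [0..<k])"
    using ex_turing_machine[of k "Seq (prepare k) (emit_all k bs)"] by (auto simp: k_def)
  obtain p where p: "\<And>L. L * 6 + 15 + emit_all_cost L bs = poly p L"
    using polynomial_fun_add[OF polynomial_fun_add[OF polynomial_fun_mult[OF polynomial_fun_id
          polynomial_fun_const] polynomial_fun_const] polynomial_fun_emit_all_cost, of 6 15 bs]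
    unfolding polynomial_fun_def by blast
  have "tm_computes_within M (poly p (length w)) w (concat (map (formula_table E n) bs))"
    if w: "length w = n * n + n + 1" "\<forall>i<n. w ! i" "\<not> w ! n"
      "\<forall>a<n. \<forall>b<n. w ! ((a + 1) * n + b + 1) = E a b" for w n E
  proof -
    interpret head_machine k w n E
    proof
      show "5 \<le> k" by (simp add: k_def)
    qed (use w in blast)+
    let ?s = "\<lambda>i::nat. if i = 0 then (word_contents w, 0::int) else (word_contents [], 0)"
    have "(word_contents w, 0) # replicate (k - 1) (word_contents [], 0) = map ?s [0..<k]"
      by (rule nth_equalityI) (auto simp: nth_Cons' k_def)
    then have "tm_init M w = (0, map ?s [0..<k])"
      using M(2) by (simp add: tm_init_def)
    then have "(tm_step M ^^ poly p (length w)) (tm_init M w) =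
        (states M, map (conf n heads0 (concat (map (formula_table E n) bs))) [0..<k])"
      using M(3)[OF runs_prepare_emit_all[OF k']] p by simp
    then show ?thesis
      using k by (simp add: tm_computes_within_def last_map last_upt conf_def)
  qed
  then show ?thesis using M(1) by blast
qed

section \<open>Relations given by patterns\<close>

text \<open>One labelling \<open>x\<close> serves all pairs of \<open>ps\<close>, so a label that
  recurs in several pairs stands for the same vertex. With \<open>adjacent\<close> and
  \<open>index_pairs k\<close> for \<open>2 \<le> k\<close>, the labellings are the increasing
  enumerations of the cliques of size \<open>k\<close>.\<close>

definition pattern_rel ::
  "(nat \<Rightarrow> nat \<Rightarrow> bool) \<Rightarrow> (nat \<Rightarrow> nat \<Rightarrow> formula) \<Rightarrow> nat \<Rightarrow> (nat \<times> nat) list \<Rightarrow> nat list set" where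
  "pattern_rel E \<alpha> n ps = {map (\<lambda>(i, j). x i * n + x j) ps | x.
     \<forall>(i, j)\<in>set ps. x i < x j \<and> x j < n \<and> holds E [x i, x j] (\<alpha> 0 1)}"

text \<open>A formula scheme in two argument positions. Uniformity allows it to be specified at the
  positions \<open>0\<close>, \<open>1\<close> and instantiated at any two entries of a longer
  tuple.\<close>

definition binary_formula :: "(nat \<Rightarrow> nat \<Rightarrow> formula) \<Rightarrow> bool" where
  "binary_formula \<alpha> \<longleftrightarrow>
     (\<forall>E t p q. holds E t (\<alpha> p q) = holds E [t ! p, t ! q] (\<alpha> 0 1)) \<and>
     (\<forall>e p q. p < e \<longrightarrow> q < e \<longrightarrow> p \<noteq> q \<longrightarrow> wf_formula e (\<alpha> p q))"

definition conj_list :: "formula list \<Rightarrow> formula" where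
  "conj_list \<phi>s = foldr Conj \<phi>s Verum"

lemma holds_conj_list: "holds E t (conj_list \<phi>s) \<longleftrightarrow> (\<forall>\<phi>\<in>set \<phi>s. holds E t \<phi>)"
  by (induction \<phi>s) (auto simp: conj_list_def)

lemma wf_conj_list: "wf_formula e (conj_list \<phi>s) \<longleftrightarrow> (\<forall>\<phi>\<in>set \<phi>s. wf_formula e \<phi>)"
  by (induction \<phi>s) (auto simp: conj_list_def)

text \<open>\<open>p\<close> is a position in the tuple of double length, where quotients stand at
  even and remainders at odd positions.\<close>

definition label :: "(nat \<times> nat) list \<Rightarrow> nat \<Rightarrow> nat" where
  "label ps p = (if even p then fst (ps ! (p div 2)) else snd (ps ! (p div 2)))"

text \<open>
  A tuple over \<open>{..<n * n}\<close> is read as a tuple over \<open>{..<n}\<close> of twice the length, by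
  \<open>v \<mapsto> (v div n, v mod n)\<close>. This respects the lexicographic order, so that the encoding of a pattern
  relation is the table of this formula.
\<close>

definition pattern_formula ::
  "(nat \<Rightarrow> nat \<Rightarrow> formula) \<Rightarrow> (nat \<times> nat) list \<Rightarrow> formula" where
  "pattern_formula \<alpha> ps = conj_list
     ([Neg (Less p q). p \<leftarrow> [0..<2 * length ps], q \<leftarrow> [0..<2 * length ps],
         p \<noteq> q \<and> label ps p = label ps q] @
      [Conj (Less (2 * l) (2 * l + 1)) (\<alpha> (2 * l) (2 * l + 1)). l \<leftarrow> [0..<length ps]])"

lemma wf_pattern_formula: "binary_formula \<alpha> \<Longrightarrow> wf_formula (2 * length ps) (pattern_formula \<alpha> ps)"
  by (auto simp: pattern_formula_def wf_conj_list binary_formula_def)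

lemma holds_pattern_formula:
  assumes "binary_formula \<alpha>"
  shows "holds E t (pattern_formula \<alpha> ps) \<longleftrightarrow>
    (\<forall>p<2 * length ps. \<forall>q<2 * length ps. label ps p = label ps q \<longrightarrow> t ! p = t ! q) \<and>
    (\<forall>l<length ps. t ! (2 * l) < t ! (2 * l + 1) \<and>
       holds E [t ! (2 * l), t ! (2 * l + 1)] (\<alpha> 0 1))"
proof -
  have "holds E t (\<alpha> p q) = holds E [t ! p, t ! q] (\<alpha> 0 1)" for p q
    using assms by (auto simp: binary_formula_def)
  then have "holds E t (pattern_formula \<alpha> ps) \<longleftrightarrow>
    (\<forall>p<2 * length ps. \<forall>q<2 * length ps. p \<noteq> q \<and> label ps p = label ps q \<longrightarrow> \<not> t ! p < t ! q) \<and>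
    (\<forall>l<length ps. t ! (2 * l) < t ! (2 * l + 1) \<and>
       holds E [t ! (2 * l), t ! (2 * l + 1)] (\<alpha> 0 1))"
    by (auto simp: pattern_formula_def holds_conj_list ball_Un)
  \<comment> \<open>Equality is not a formula; it is obtained by forbidding \<open><\<close> in both
    directions.\<close>
  then show ?thesis by (metis less_irrefl linorder_neqE_nat)
qed

definition unpair_list :: "nat \<Rightarrow> nat list \<Rightarrow> nat list" where
  "unpair_list n u = concat (map (\<lambda>v. [v div n, v mod n]) u)"

lemma nth_unpair_list:
  "p < 2 * length u \<Longrightarrow>
    unpair_list n u ! p = (if even p then u ! (p div 2) div n else u ! (p div 2) mod n)"
proof (induction u arbitrary: p)
  case (Cons v u)
  consider "p = 0" | "p = 1" | q where "p = Suc (Suc q)" by (metis One_nat_def not0_implies_Suc)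
  then show ?case
    by cases (use Cons in \<open>auto simp: unpair_list_def\<close>)
qed simp

lemma holds_pattern_formula_iff:
  assumes "binary_formula \<alpha>" "length u = length ps" "set u \<subseteq> {..<n * n}"
  shows "holds E (unpair_list n u) (pattern_formula \<alpha> ps) \<longleftrightarrow> u \<in> pattern_rel E \<alpha> n ps"
proof -
  let ?t = "unpair_list n u"
  have nth: "?t ! (2 * l) = u ! l div n" "?t ! (2 * l + 1) = u ! l mod n" if "l < length ps" for l
    using nth_unpair_list[of "2 * l" u n] nth_unpair_list[of "2 * l + 1" u n] that assms(2) by auto
  show ?thesis
  proof
    assume "holds E ?t (pattern_formula \<alpha> ps)"
    then have t: "(\<forall>p<2 * length ps. \<forall>q<2 * length ps. label ps p = label ps q \<longrightarrow> ?t ! p = ?t ! q) \<and>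
        (\<forall>l<length ps. ?t ! (2 * l) < ?t ! (2 * l + 1) \<and>
          holds E [?t ! (2 * l), ?t ! (2 * l + 1)] (\<alpha> 0 1))"
      unfolding holds_pattern_formula[OF assms(1)] .
    have eq: "?t ! p = ?t ! q"
      if "p < 2 * length ps" "q < 2 * length ps" "label ps p = label ps q" for p q
      using conjunct1[OF t] that by blast
    have adj: "?t ! (2 * l) < ?t ! (2 * l + 1)" "holds E [?t ! (2 * l), ?t ! (2 * l + 1)] (\<alpha> 0 1)"
      if "l < length ps" for l
      using conjunct2[OF t] that by blast+
    \<comment> \<open>By \<open>eq\<close>, all positions with the same label carry the same entry,
      so any of them will do; a label that does not occur gets an arbitrary value.\<close>
    define x where "x i = ?t ! (SOME p. p < 2 * length ps \<and> label ps p = i)" for i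
    have x: "x (label ps p) = ?t ! p" if "p < 2 * length ps" for p
    proof -
      let ?P = "\<lambda>q. q < 2 * length ps \<and> label ps q = label ps p"
      have some: "?P (SOME q. ?P q)" by (rule someI[of ?P p]) (simp add: that)
      show ?thesis
        unfolding x_def by (rule eq[OF conjunct1[OF some] that conjunct2[OF some]])
    qed
    have xl: "x (fst (ps ! l)) = u ! l div n" "x (snd (ps ! l)) = u ! l mod n" if "l < length ps" for l
      using x[of "2 * l"] x[of "2 * l + 1"] nth[OF that] that by (auto simp: label_def)
    have "u = map (\<lambda>(i, j). x i * n + x j) ps"
      by (rule nth_equalityI) (use assms(2) xl in \<open>auto simp: case_prod_beta\<close>)
    moreover have "x i < x j \<and> x j < n \<and> holds E [x i, x j] (\<alpha> 0 1)"
      if ij: "(i, j) \<in> set ps" for i j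
    proof -
      obtain l where l: "l < length ps" "ps ! l = (i, j)" using ij by (auto simp: in_set_conv_nth)
      have "u ! l < n * n" using assms(2,3) l(1) by (metis lessThan_iff nth_mem subsetD)
      then have "0 < n" by (cases n) auto
      then show ?thesis using xl[OF l(1)] adj[OF l(1)] nth[OF l(1)] l(2) by simp
    qed
    ultimately show "u \<in> pattern_rel E \<alpha> n ps" unfolding pattern_rel_def by blast
  next
    assume "u \<in> pattern_rel E \<alpha> n ps"
    then obtain x where u: "u = map (\<lambda>(i, j). x i * n + x j) ps"
      and x: "\<forall>(i, j)\<in>set ps. x i < x j \<and> x j < n \<and> holds E [x i, x j] (\<alpha> 0 1)"
      unfolding pattern_rel_def by blast
    have ul: "u ! l div n = x (fst (ps ! l))" "u ! l mod n = x (snd (ps ! l))"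
      "x (fst (ps ! l)) < x (snd (ps ! l))"
      "holds E [x (fst (ps ! l)), x (snd (ps ! l))] (\<alpha> 0 1)" if "l < length ps" for l
    proof -
      have "ps ! l \<in> set ps" using that by simp
      then show "x (fst (ps ! l)) < x (snd (ps ! l))"
        "holds E [x (fst (ps ! l)), x (snd (ps ! l))] (\<alpha> 0 1)"
        and "u ! l div n = x (fst (ps ! l))" "u ! l mod n = x (snd (ps ! l))"
        using bspec[OF x, of "ps ! l"] that by (simp_all add: u case_prod_beta)
    qed
    have "?t ! p = x (label ps p)" if "p < 2 * length ps" for p
    proof -
      have "p div 2 < length ps" using that by simp
      then show ?thesis using nth_unpair_list[of p u n] that ul by (simp add: label_def assms(2))
    qed
    then show "holds E ?t (pattern_formula \<alpha> ps)"
      unfolding holds_pattern_formula[OF assms(1)] using nth ul by auto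
  qed
qed

text \<open>On each of the \<open>m\<close> consecutive blocks of length \<open>n\<close> the
  quotient is constant and the remainder runs through \<open>[0..<n]\<close>.\<close>

lemma map_div_mod_upt:
  "map (\<lambda>v. (v div n, v mod n)) [0..<m * n] = List.product [0..<m] [0..<n]"
proof (induction m)
  case (Suc m)
  have "[0..<Suc m * n] = [0..<m * n] @ [m * n..<m * n + n]"
    using upt_add_eq_append[of 0 "m * n" n] by (simp add: add.commute)
  also have "[m * n..<m * n + n] = map (\<lambda>b. b + m * n) [0..<n]"
    by (simp add: map_add_upt add.commute)
  finally have "[0..<Suc m * n] = [0..<m * n] @ map (\<lambda>b. b + m * n) [0..<n]" .
  then show ?case using Suc by (simp add: product_concat_map comp_def)
qed simp

text \<open>Equality of lists, not only of sets: the order of the tuples is part of the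
  encoding.\<close>

lemma map_unpair_list:
  "map (unpair_list n) (product_lists (replicate d [0..<n * n])) =
    product_lists (replicate (2 * d) [0..<n])"
proof (induction d)
  case (Suc d)
  let ?P = "product_lists (replicate d [0..<n * n])"
  let ?Q = "product_lists (replicate (2 * d) [0..<n])"
  have "map (unpair_list n) (product_lists (replicate (Suc d) [0..<n * n])) =
      concat (map (\<lambda>v. map (\<lambda>u. (v div n) # (v mod n) # u) (map (unpair_list n) ?P)) [0..<n * n])"
    by (simp add: map_concat comp_def unpair_list_def)
  also have "\<dots> = concat (map (\<lambda>(a, b). map (\<lambda>u. a # b # u) ?Q)
      (map (\<lambda>v. (v div n, v mod n)) [0..<n * n]))"
    by (simp add: Suc comp_def)
  also have "\<dots> = product_lists (replicate (2 * Suc d) [0..<n])"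
    by (simp add: map_div_mod_upt product_concat_map map_concat concat_map_concat comp_def)
  finally show ?case .
qed (simp add: unpair_list_def)

lemma in_product_lists_upt:
  "u \<in> set (product_lists (replicate d [0..<m])) \<longleftrightarrow> length u = d \<and> set u \<subseteq> {..<m}"
proof (induction d arbitrary: u)
  case (Suc d)
  then show ?case by (cases u) (auto simp: image_iff)
qed auto

lemma formula_table_pattern_formula:
  assumes "binary_formula \<alpha>"
  shows "formula_table E n (2 * length ps, pattern_formula \<alpha> ps) =
    map (\<lambda>u. u \<in> pattern_rel E \<alpha> n ps) (product_lists (replicate (length ps) [0..<n * n]))"
  unfolding formula_table_def prod.case map_unpair_list[symmetric] map_map comp_def
  by (rule map_cong[OF refl], rule holds_pattern_formula_iff[OF assms])
    (auto simp: in_product_lists_upt)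

section \<open>Pattern structures and their encodings\<close>

definition pattern_sig :: "((nat \<Rightarrow> nat \<Rightarrow> formula) \<times> (nat \<times> nat) list) list \<Rightarrow> signature" where
  "pattern_sig specs = map (\<lambda>(\<alpha>, ps). length ps) specs"

definition pattern_structure ::
  "((nat \<Rightarrow> nat \<Rightarrow> formula) \<times> (nat \<times> nat) list) list \<Rightarrow> nat pair_pre_digraph \<Rightarrow> nat rel_structure"
where
  "pattern_structure specs D = (let n = card (pverts D) in
     \<lparr>univ = {..<n * n},
      rels = map (\<lambda>(\<alpha>, ps). pattern_rel (\<lambda>a b. (a, b) \<in> parcs D) \<alpha> n ps) specs\<rparr>)"

text \<open>The header of the encoding is printed as tables too: \<open>Verum\<close> with two
  variables yields the \<open>n * n\<close> marks for the size of the universe, and a false formula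
  without variables yields the delimiter bit.\<close>

definition pattern_tables ::
  "((nat \<Rightarrow> nat \<Rightarrow> formula) \<times> (nat \<times> nat) list) list \<Rightarrow> (nat \<times> formula) list" where
  "pattern_tables specs =
     (2, Verum) # (0, Neg Verum) # map (\<lambda>(\<alpha>, ps). (2 * length ps, pattern_formula \<alpha> ps)) specs"

lemma length_product_lists_replicate: "length (product_lists (replicate d xs)) = length xs ^ d"
  by (induction d) (auto simp: length_concat comp_def sum_list_triv)

lemma encode_pattern_structure:
  assumes "\<forall>(\<alpha>, ps)\<in>set specs. binary_formula \<alpha>"
  shows "encode_structure (pattern_sig specs) (pattern_structure specs D) =
    concat (map (formula_table (\<lambda>a b. (a, b) \<in> parcs D) (card (pverts D))) (pattern_tables specs))"
proof -
  let ?n = "card (pverts D)" and ?E = "\<lambda>a b. (a, b) \<in> parcs D"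
  have "formula_table ?E ?n (2, Verum) = replicate (?n * ?n) True"
    using length_product_lists_replicate[of 2 "[0..<?n]"]
    by (simp add: formula_table_def map_replicate_const power2_eq_square del: product_lists.simps)
  moreover have "map2 (\<lambda>k R. map (\<lambda>t. t \<in> R) (product_lists (replicate k [0..<?n * ?n])))
      (pattern_sig specs) (rels (pattern_structure specs D)) =
      map (formula_table ?E ?n) (map (\<lambda>(\<alpha>, ps). (2 * length ps, pattern_formula \<alpha> ps)) specs)"
    using assms formula_table_pattern_formula[of _ ?E ?n]
    by (auto simp: pattern_sig_def pattern_structure_def Let_def zip_map_map zip_same_conv_map)
  ultimately show ?thesis
    by (simp add: encode_structure_def pattern_structure_def Let_def pattern_tables_def
        formula_table_def)
qed

lemma encode_digraph_props:
  fixes D :: "nat pair_pre_digraph"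
  defines "n \<equiv> card (pverts D)"
  shows "length (encode_digraph D) = n * n + n + 1"
    and "i < n \<Longrightarrow> encode_digraph D ! i" and "\<not> encode_digraph D ! n"
    and "a < n \<Longrightarrow> b < n \<Longrightarrow> encode_digraph D ! ((a + 1) * n + b + 1) = ((a, b) \<in> parcs D)"
proof -
  let ?R = "{[x, y] | x y. (x, y) \<in> parcs D}"
  let ?vs = "map (\<lambda>v. [v div n, v mod n] \<in> ?R) [0..<n * n]"
  have "product_lists (replicate 2 [0..<n]) = map (\<lambda>v. [v div n, v mod n]) [0..<n * n]"
    using map_unpair_list[of n 1] by (simp add: unpair_list_def numeral_2_eq_2 comp_def)
  then have enc: "encode_digraph D = replicate n True @ [False] @ ?vs"
    by (simp add: encode_digraph_def encode_structure_def Let_def n_def comp_def)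
  show "length (encode_digraph D) = n * n + n + 1"
    and "i < n \<Longrightarrow> encode_digraph D ! i" and "\<not> encode_digraph D ! n"
    by (simp_all add: enc nth_append)
  assume ab: "a < n" "b < n"
  then have "(a + 1) * n \<le> n * n" by (intro mult_right_mono) auto
  then have "a * n + b < n * n" using ab by simp
  then show "encode_digraph D ! ((a + 1) * n + b + 1) = ((a, b) \<in> parcs D)"
    using ab by (simp add: enc nth_append)
qed

text \<open>This separates machines from combinatorics: what remains for a concrete problem is the
  equivalence \<open>yes\<close>.\<close>

lemma polytime_reduction_pattern_structure:
  assumes specs: "\<forall>(\<alpha>, ps)\<in>set specs. binary_formula \<alpha>"
    and P: "encode P = encode_digraph"
    and yes: "\<And>D. D \<in> instances P \<Longrightarrow>
      yes_instance P D \<longleftrightarrow> (\<exists>h. homomorphism (pattern_sig specs) h (pattern_structure specs D) B)"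
  shows "polytime_reduction P (CSP (pattern_sig specs) B) (pattern_structure specs)"
proof -
  have "is_structure (pattern_sig specs) (pattern_structure specs D)" for D
  proof -
    let ?n = "card (pverts D)"
    have "a * ?n + b < ?n * ?n" if "a < b" "b < ?n" for a b
    proof -
      have "(a + 1) * ?n \<le> ?n * ?n" using that by (intro mult_right_mono) auto
      then show ?thesis using that by simp
    qed
    then show ?thesis
      by (fastforce simp: is_structure_def pattern_sig_def pattern_structure_def Let_def
          pattern_rel_def case_prod_beta)
  qed
  moreover have "\<exists>n. univ (pattern_structure specs D) = {..<n}" for D
    by (auto simp: pattern_structure_def Let_def)
  moreover have "\<forall>(e, \<phi>)\<in>set (pattern_tables specs). wf_formula e \<phi>"
    using specs wf_pattern_formula by (auto simp: pattern_tables_def)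
  then obtain M and p :: "nat poly" where M: "wf_turing_machine M"
    "\<And>w n E. length w = n * n + n + 1 \<Longrightarrow> (\<forall>i<n. w ! i) \<Longrightarrow> \<not> w ! n \<Longrightarrow>
      (\<forall>a<n. \<forall>b<n. w ! ((a + 1) * n + b + 1) = E a b) \<Longrightarrow>
      tm_computes_within M (poly p (length w)) w
        (concat (map (formula_table E n) (pattern_tables specs)))"
    using ex_formula_table_machine[of "pattern_tables specs"] by blast
  have "tm_computes_within M (poly p (length (encode_digraph D))) (encode_digraph D)
      (encode_structure (pattern_sig specs) (pattern_structure specs D))" for D
    unfolding encode_pattern_structure[OF specs]
    by (rule M(2)) (use encode_digraph_props[where D = D] in blast)+
  ultimately have comp: "wf_turing_machine M \<and> (\<forall>D\<in>instances P.
      tm_computes_within M (poly p (length (encode P D))) (encode P D)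
        (encode (CSP (pattern_sig specs) B) (pattern_structure specs D)))"
    and inst: "pattern_structure specs D \<in> instances (CSP (pattern_sig specs) B)" for D
    using M(1) by (auto simp: P CSP_def)
  show ?thesis
    unfolding polytime_reduction_def
  proof (intro conjI ballI exI)
    fix D assume "D \<in> instances P"
    then show "yes_instance P D \<longleftrightarrow>
        yes_instance (CSP (pattern_sig specs) B) (pattern_structure specs D)"
      by (simp add: yes CSP_def)
  qed (use comp inst in blast)+
qed

section \<open>Homomorphisms and orientations\<close>

definition adjacent :: "nat \<Rightarrow> nat \<Rightarrow> formula" where
  "adjacent p q = Neg (Conj (Neg (Edge p q)) (Neg (Edge q p)))"

definition only_forward :: "nat \<Rightarrow> nat \<Rightarrow> formula" where
  "only_forward p q = Conj (Edge p q) (Neg (Edge q p))"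

definition only_backward :: "nat \<Rightarrow> nat \<Rightarrow> formula" where
  "only_backward p q = only_forward q p"

lemma binary_formulas:
  "binary_formula adjacent" "binary_formula only_forward" "binary_formula only_backward"
  by (auto simp: binary_formula_def adjacent_def only_forward_def only_backward_def)

lemma set_index_pairs: "set (index_pairs k) = {(i, j). 1 \<le> i \<and> i < j \<and> j \<le> k}"
  by (auto simp: index_pairs_def image_iff simp del: upt_Suc)

lemma length_index_pairs: "length (index_pairs k) = k choose 2"
proof -
  have "length (index_pairs k) = (\<Sum>i = 1..<Suc k. k - i)"
    by (simp add: index_pairs_def length_concat comp_def interv_sum_list_conv_sum_set_nat
        del: upt_Suc)
  also have "\<dots> = k choose 2"
  proof (induction k)
    case (Suc k)
    have "(\<Sum>i = 1..<Suc (Suc k). Suc k - i) = (\<Sum>i = 1..<Suc k. (k - i) + 1)"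
      by (simp add: Suc_diff_le)
    also have "\<dots> = (k choose 2) + k" unfolding sum.distrib Suc by simp
    also have "\<dots> = Suc k choose 2" by (simp add: numeral_2_eq_2)
    finally show ?case .
  qed simp
  finally show ?thesis .
qed

definition clique_specs :: "nat \<Rightarrow> ((nat \<Rightarrow> nat \<Rightarrow> formula) \<times> (nat \<times> nat) list) list" where
  "clique_specs m = map (\<lambda>k. (adjacent, index_pairs k)) [2..<Suc m]"

text \<open>The order follows the constants: an edge that leads only from the larger vertex to the
  smaller has the value 0, and \<open>{[0]}\<close> comes first.\<close>

definition const_specs :: "((nat \<Rightarrow> nat \<Rightarrow> formula) \<times> (nat \<times> nat) list) list" where
  "const_specs = [(only_backward, [(1, 2)]), (only_forward, [(1, 2)])]"

lemma pattern_sig_clique_specs: "pattern_sig (clique_specs (max_order F)) = bool_sig F"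
  by (simp add: pattern_sig_def clique_specs_def bool_sig_def comp_def length_index_pairs)

lemma pattern_sig_const_specs:
  "pattern_sig (clique_specs (max_order F) @ const_specs) = bool_sig_consts F"
  using pattern_sig_clique_specs[of F]
  by (simp add: bool_sig_consts_def pattern_sig_def const_specs_def)

lemma homomorphism_iff_list_all2:
  "length (rels A) = length \<sigma> \<Longrightarrow> length (rels B) = length \<sigma> \<Longrightarrow>
    homomorphism \<sigma> h A B \<longleftrightarrow> h ` univ A \<subseteq> univ B \<and>
      list_all2 (\<lambda>R S. \<forall>t\<in>R. map h t \<in> S) (rels A) (rels B)"
  by (simp add: homomorphism_def list_all2_conv_all_nth)

lemma parcs_mk_symmetric_with_proj:
  "parcs (mk_symmetric (with_proj D)) = parcs D \<union> (parcs D)\<inverse>"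
proof
  show "parcs D \<union> (parcs D)\<inverse> \<subseteq> parcs (mk_symmetric (with_proj D))"
  proof
    fix e assume "e \<in> parcs D \<union> (parcs D)\<inverse>"
    then consider "e \<in> parcs D" | "prod.swap e \<in> parcs D" by (cases e) auto
    then show "e \<in> parcs (mk_symmetric (with_proj D))"
    proof cases
      case 1
      then show ?thesis by (auto simp: parcs_mk_symmetric intro: bexI[of _ e])
    next
      case 2
      then show ?thesis by (cases e) (auto simp: parcs_mk_symmetric intro: bexI[of _ "prod.swap e"])
    qed
  qed
qed (auto simp: parcs_mk_symmetric)

section \<open>Completions free of \<open>F\<close> and homomorphisms\<close>

context
  fixes F :: "'v pair_pre_digraph set" and D :: "nat pair_pre_digraph" and n :: nat
  assumes F: "finite F" "\<forall>T\<in>F. tournament T \<and> finite (pverts T) \<and> 2 \<le> card (pverts T)"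
    and D: "pair_digraph D" "pverts D = {..<n}"
begin

abbreviation edge :: "nat \<Rightarrow> nat \<Rightarrow> bool" where
  "edge \<equiv> \<lambda>a b. (a, b) \<in> parcs D"

definition respects_cliques :: "(nat \<Rightarrow> nat) \<Rightarrow> bool" where
  "respects_cliques h \<longleftrightarrow> h ` {..<n * n} \<subseteq> {0, 1} \<and>
     (\<forall>k\<in>{2..max_order F}. \<forall>t\<in>pattern_rel edge adjacent n (index_pairs k).
        map h t \<in> free_tournament_rel F k)"

definition respects_arcs :: "(nat \<Rightarrow> nat) \<Rightarrow> bool" where
  "respects_arcs h \<longleftrightarrow> (\<forall>a b. a < b \<longrightarrow>
     ((a, b) \<in> parcs D \<and> (b, a) \<notin> parcs D \<longrightarrow> h (a * n + b) = 1) \<and>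
     ((b, a) \<in> parcs D \<and> (a, b) \<notin> parcs D \<longrightarrow> h (a * n + b) = 0))"

lemma edgeD: "(a, b) \<in> parcs D \<Longrightarrow> a < n \<and> b < n \<and> a \<noteq> b"
proof -
  interpret pair_digraph D by (rule D)
  assume "(a, b) \<in> parcs D"
  then show ?thesis
    using arc_fst_in_verts arc_snd_in_verts pair_no_loops D(2) by fastforce
qed

lemma homomorphism_clique_specs:
  "homomorphism (bool_sig F) h (pattern_structure (clique_specs (max_order F)) D) (bool_structure F)
    \<longleftrightarrow> respects_cliques h"
  by (subst homomorphism_iff_list_all2)
    (auto simp: bool_sig_def pattern_structure_def clique_specs_def bool_structure_def Let_def D(2)
      respects_cliques_def list_all2_map1 list_all2_map2 list_all2_same comp_def simp del: upt_Suc)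

lemma homomorphism_const_specs:
  "homomorphism (bool_sig_consts F) h
      (pattern_structure (clique_specs (max_order F) @ const_specs) D) (bool_structure_consts F)
    \<longleftrightarrow> respects_cliques h \<and> respects_arcs h"
proof -
  have "(\<forall>t\<in>pattern_rel edge only_backward n [(1, 2)]. map h t \<in> {[0]}) \<longleftrightarrow>
      (\<forall>a b. a < b \<and> (b, a) \<in> parcs D \<and> (a, b) \<notin> parcs D \<longrightarrow> h (a * n + b) = 0)" (is "?l1 \<longleftrightarrow> ?r1")
  proof
    assume ?l1
    show ?r1
    proof (intro allI impI)
      fix a b assume ab: "a < b \<and> (b, a) \<in> parcs D \<and> (a, b) \<notin> parcs D"
      have "[a * n + b] \<in> pattern_rel edge only_backward n [(1, 2)]"
        using ab edgeD[of b a] unfolding pattern_rel_def only_backward_def only_forward_def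
        by (intro CollectI exI[of _ "\<lambda>i. if i = 1 then a else b"]) auto
      with \<open>?l1\<close> show "h (a * n + b) = 0" by auto
    qed
  qed (auto simp: pattern_rel_def only_backward_def only_forward_def)
  moreover have "(\<forall>t\<in>pattern_rel edge only_forward n [(1, 2)]. map h t \<in> {[1]}) \<longleftrightarrow>
      (\<forall>a b. a < b \<and> (a, b) \<in> parcs D \<and> (b, a) \<notin> parcs D \<longrightarrow> h (a * n + b) = 1)" (is "?l2 \<longleftrightarrow> ?r2")
  proof
    assume ?l2
    show ?r2
    proof (intro allI impI)
      fix a b assume ab: "a < b \<and> (a, b) \<in> parcs D \<and> (b, a) \<notin> parcs D"
      have "[a * n + b] \<in> pattern_rel edge only_forward n [(1, 2)]"
        using ab edgeD[of a b] unfolding pattern_rel_def only_forward_def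
        by (intro CollectI exI[of _ "\<lambda>i. if i = 1 then a else b"]) auto
      with \<open>?l2\<close> show "h (a * n + b) = 1" by auto
    qed
  qed (auto simp: pattern_rel_def only_forward_def)
  ultimately have "list_all2 (\<lambda>R S. \<forall>t\<in>R. map h t \<in> S)
      [pattern_rel edge only_backward n [(1, 2)], pattern_rel edge only_forward n [(1, 2)]]
      [{[0]}, {[1]}] \<longleftrightarrow> respects_arcs h"
    unfolding list_all2_Cons list_all2_Nil respects_arcs_def by blast
  note respects_iff = this
  let ?A = "pattern_structure (clique_specs (max_order F)) D"
  let ?B = "pattern_structure (clique_specs (max_order F) @ const_specs) D"
  have hom: "homomorphism (bool_sig F) h ?A (bool_structure F) \<longleftrightarrow>
      h ` univ ?A \<subseteq> univ (bool_structure F) \<and>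
      list_all2 (\<lambda>R S. \<forall>t\<in>R. map h t \<in> S) (rels ?A) (rels (bool_structure F))"
    by (rule homomorphism_iff_list_all2)
      (simp_all add: bool_sig_def pattern_structure_def clique_specs_def bool_structure_def Let_def)
  have hom_consts: "homomorphism (bool_sig_consts F) h ?B (bool_structure_consts F) \<longleftrightarrow>
      h ` univ ?B \<subseteq> univ (bool_structure_consts F) \<and>
      list_all2 (\<lambda>R S. \<forall>t\<in>R. map h t \<in> S) (rels ?B) (rels (bool_structure_consts F))"
    by (rule homomorphism_iff_list_all2)
      (simp_all add: bool_sig_def bool_sig_consts_def pattern_structure_def clique_specs_def
        const_specs_def bool_structure_def bool_structure_consts_def Let_def)
  have "univ ?B = univ ?A" by (simp add: pattern_structure_def Let_def)
  moreover have "rels ?B = rels ?A @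
      [pattern_rel edge only_backward n [(1, 2)], pattern_rel edge only_forward n [(1, 2)]]"
    by (simp add: pattern_structure_def const_specs_def Let_def D(2))
  moreover have "length (rels ?A) = length (rels (bool_structure F))"
    by (simp add: pattern_structure_def clique_specs_def bool_structure_def Let_def)
  ultimately show ?thesis
    unfolding hom_consts homomorphism_clique_specs[symmetric] hom respects_iff[symmetric]
    by (simp only: bool_structure_consts_def rel_structure.simps list_all2_append conj_assoc)
qed

text \<open>The homomorphism is the characteristic function of the arcs of \<open>D'\<close>. On a
  clique enumerated by \<open>x\<close>, pulling \<open>D'\<close> back along \<open>x\<close> gives
  a tournament on \<open>{1..k}\<close>, and \<open>x\<close> would carry any forbidden copy in it
  into \<open>D'\<close>.\<close>

lemma completion_imp_respects:
  assumes D': "orientation_completion_of D' D" "free_of F D'"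
  shows "\<exists>h. respects_cliques h \<and> respects_arcs h"
proof -
  define h where "h v = (if (v div n, v mod n) \<in> parcs D' then 1 else 0 :: nat)" for v
  have h: "h (a * n + b) = (if (a, b) \<in> parcs D' then 1 else 0)" if "b < n" for a b
    using that by (simp add: h_def)
  have sub: "parcs D' \<subseteq> parcs D"
    using D'(1) unfolding orientation_completion_of_def by blast
  have choice: "if edge b a then (a, b) \<in> parcs D' \<longleftrightarrow> (b, a) \<notin> parcs D' else (a, b) \<in> parcs D'"
    if "edge a b" for a b
    using D'(1) that unfolding orientation_completion_of_def by blast
  have total: "(a, b) \<in> parcs D' \<or> (b, a) \<in> parcs D'" if "edge a b \<or> edge b a" for a b
    using choice[of a b] choice[of b a] that by (auto split: if_splits)
  have anti: "(b, a) \<notin> parcs D'" if "(a, b) \<in> parcs D'" for a b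
    using choice[of a b] subsetD[OF sub that] subsetD[OF sub, of "(b, a)"] that
    by (auto split: if_splits)
  have no_loop: "(a, a) \<notin> parcs D'" for a
    using sub edgeD[of a a] by blast
  have "map h t \<in> free_tournament_rel F k" if t: "t \<in> pattern_rel edge adjacent n (index_pairs k)" for k t
  proof -
    obtain x where x: "t = map (\<lambda>(i, j). x i * n + x j) (index_pairs k)"
      "\<forall>(i, j)\<in>set (index_pairs k). x i < x j \<and> x j < n \<and> holds edge [x i, x j] (adjacent 0 1)"
      using t unfolding pattern_rel_def by blast
    have xij: "x i < x j" "x j < n" "edge (x i) (x j) \<or> edge (x j) (x i)"
      if "1 \<le> i" "i < j" "j \<le> k" for i j
      using x(2) that unfolding set_index_pairs by (auto simp: adjacent_def)
    define T where "T = \<lparr>pverts = {1..k}, parcs = {(i, j). i \<in> {1..k} \<and> j \<in> {1..k} \<and> (x i, x j) \<in> parcs D'}\<rparr>"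
    have inj: "inj_on x {1..k}"
      by (rule linorder_inj_onI) (use xij in fastforce)+
    have "oriented_graph T"
      unfolding oriented_graph_def
    proof
      show "pair_loopfree_digraph T"
        by unfold_locales (use no_loop in \<open>auto simp: T_def\<close>)
      show "\<forall>i j. \<not> ((i, j) \<in> parcs T \<and> (j, i) \<in> parcs T)"
        using anti by (auto simp: T_def)
    qed
    moreover have "(i, j) \<in> parcs T \<or> (j, i) \<in> parcs T"
      if "i \<in> pverts T" "j \<in> pverts T" "i \<noteq> j" for i j
      using that xij[of i j] xij[of j i] total[of "x i" "x j"] by (cases "i < j") (auto simp: T_def)
    ultimately have "tournament T" unfolding tournament_def by blast
    moreover have "free_of F T"
      unfolding free_of_def
    proof (intro ballI notI)
      fix S assume "S \<in> F" "embeds S T"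
      then obtain f where f: "inj_on f (pverts S)" "f ` pverts S \<subseteq> {1..k}"
        "\<And>u v. u \<in> pverts S \<Longrightarrow> v \<in> pverts S \<Longrightarrow> (u, v) \<in> parcs S \<longleftrightarrow> (f u, f v) \<in> parcs T"
        unfolding embeds_def by (auto simp: T_def)
      \<comment> \<open>For \<open>2 \<le> k\<close> every index occurs in some pair, which is what
        makes all \<open>x i\<close> vertices; for \<open>k = 1\<close> nothing would be known about
        \<open>x 1\<close>.\<close>
      have "2 \<le> card (pverts S)" using F(2) \<open>S \<in> F\<close> by blast
      then have "2 \<le> k" using card_mono[OF _ f(2)] card_image[OF f(1)] by simp
      have xn: "x i < n" if "i \<in> {1..k}" for i
        using that \<open>2 \<le> k\<close> xij[of i k] xij[of 1 k] by (cases "i = k") fastforce+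
      have "embeds S D'"
        unfolding embeds_def
      proof (intro exI conjI ballI)
        show "inj_on (x \<circ> f) (pverts S)" using f inj by (intro comp_inj_on inj_on_subset[OF inj])
        have "pverts D' = {..<n}" using D'(1) D(2) by (simp add: orientation_completion_of_def)
        then show "(x \<circ> f) ` pverts S \<subseteq> pverts D'" using f(2) xn by auto
        show "(u, v) \<in> parcs S \<longleftrightarrow> ((x \<circ> f) u, (x \<circ> f) v) \<in> parcs D'"
          if "u \<in> pverts S" "v \<in> pverts S" for u v
          using f(3)[OF that] f(2) that by (auto simp: T_def)
      qed
      then show False using D'(2) \<open>S \<in> F\<close> by (auto simp: free_of_def)
    qed
    moreover have "map h t = tournament_vec k T"
      using xij h by (auto simp: x(1) tournament_vec_def set_index_pairs T_def)
    ultimately show ?thesis unfolding free_tournament_rel_def by (auto simp: T_def)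
  qed
  moreover have "h ` {..<n * n} \<subseteq> {0, 1}" by (auto simp: h_def)
  moreover have "respects_arcs h"
    unfolding respects_arcs_def using h edgeD sub D'(1)
    by (auto simp: orientation_completion_of_def)
  ultimately show ?thesis unfolding respects_cliques_def by blast
qed

text \<open>Each edge is directed by the bit of its increasing pair. A copy of \<open>T\<close> in
  \<open>D'\<close> would lie on a clique, where the bits describe some tournament \<open>T'\<close>
  that is free of \<open>F\<close>; the enumeration of the clique is an isomorphism from
  \<open>T'\<close>, so that \<open>T\<close> would embed into \<open>T'\<close>.\<close>

lemma respects_imp_completion:
  assumes "respects_cliques h" "respects_arcs h"
  shows "\<exists>D'. orientation_completion_of D' D \<and> free_of F D'"
proof -
  define D' where "D' = \<lparr>pverts = pverts D, parcs = {(a, b). (edge a b \<or> edge b a) \<and>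
    (if a < b then h (a * n + b) = 1 else h (b * n + a) = 0)}\<rparr>"
  have lt: "a * n + b < n * n" if "a < n" "b < n" for a b
  proof -
    have "(a + 1) * n \<le> n * n" using that by (intro mult_right_mono) auto
    then show ?thesis using that by simp
  qed
  have h01: "h (a * n + b) = 0 \<or> h (a * n + b) = 1" if "a < n" "b < n" for a b
    using assms(1) lt[OF that] unfolding respects_cliques_def by blast
  have anti: "(a, b) \<in> parcs D' \<longleftrightarrow> (b, a) \<notin> parcs D'" if "edge a b \<or> edge b a" for a b
    using that edgeD[of a b] edgeD[of b a] h01[of a b] h01[of b a]
    by (cases a b rule: linorder_cases) (auto simp: D'_def)
  \<comment> \<open>Here the constants enter: they give a one-way edge its only admissible
    direction.\<close>
  have sub: "parcs D' \<subseteq> parcs D"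
  proof (rule subrelI, rule ccontr)
    fix a b assume ab: "(a, b) \<in> parcs D'" "(a, b) \<notin> parcs D"
    then have ba: "(b, a) \<in> parcs D" by (auto simp: D'_def)
    show False
    proof (cases "a < b")
      case True
      then have "h (a * n + b) = 1" using ab(1) by (simp add: D'_def)
      moreover have "h (a * n + b) = 0"
        using assms(2) True ab(2) ba unfolding respects_arcs_def by blast
      ultimately show False by simp
    next
      case False
      then have "b < a" using edgeD[OF ba] by simp
      then have "h (b * n + a) = 0" using ab(1) by (simp add: D'_def)
      moreover have "h (b * n + a) = 1"
        using assms(2) \<open>b < a\<close> ab(2) ba unfolding respects_arcs_def by blast
      ultimately show False by simp
    qed
  qed
  have "orientation_completion_of D' D"
    unfolding orientation_completion_of_def
  proof (intro conjI allI impI)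
    fix a b assume "edge a b"
    then show "if (b, a) \<in> parcs D then (a, b) \<in> parcs D' \<longleftrightarrow> (b, a) \<notin> parcs D'
        else (a, b) \<in> parcs D'"
      using anti[of a b] subsetD[OF sub, of "(b, a)"] by presburger
  qed (use sub in \<open>simp_all add: D'_def\<close>)
  moreover have "free_of F D'"
    unfolding free_of_def
  proof (intro ballI notI)
    fix T assume T: "T \<in> F" "embeds T D'"
    then obtain f where f: "inj_on f (pverts T)" "f ` pverts T \<subseteq> {..<n}"
      "\<And>u v. u \<in> pverts T \<Longrightarrow> v \<in> pverts T \<Longrightarrow> (u, v) \<in> parcs T \<longleftrightarrow> (f u, f v) \<in> parcs D'"
      unfolding embeds_def using D(2) by (auto simp: D'_def)
    have tT: "tournament T" "finite (pverts T)" "2 \<le> card (pverts T)" using F(2) T(1) by auto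
    define k where "k = card (pverts T)"
    have k: "k \<in> {2..max_order F}"
      using tT(3) T(1) F(1) by (auto simp: k_def max_order_def intro!: Max_ge)
    define S where "S = f ` pverts T"
    have S: "finite S" "card S = k" "S \<subseteq> {..<n}"
      using tT(2) f(1,2) by (auto simp: S_def k_def card_image)
    \<comment> \<open>The pattern relation contains only increasing enumerations, so the clique is
      sorted.\<close>
    define xs where "xs = sorted_list_of_set S"
    have xs: "sorted_wrt (<) xs" "set xs = S" "length xs = k"
      using S by (auto simp: xs_def)
    define x where "x i = xs ! (i - 1)" for i
    have x_less: "x i < x j" if "1 \<le> i" "i < j" "j \<le> k" for i j
      using xs(1,3) that by (auto simp: x_def sorted_wrt_iff_nth_less)
    have x_in: "x i \<in> S" if "i \<in> {1..k}" for i
      using xs(2,3) that by (auto simp: x_def)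
    have x_surj: "S \<subseteq> x ` {1..k}"
    proof
      fix a assume "a \<in> S"
      then obtain l where "l < k" "xs ! l = a" using xs(2,3) by (auto simp: in_set_conv_nth)
      then show "a \<in> x ` {1..k}" by (intro image_eqI[of _ _ "Suc l"]) (auto simp: x_def)
    qed
    have x_inj: "inj_on x {1..k}"
      by (rule linorder_inj_onI) (use x_less in fastforce)+
    have adj: "edge a b \<or> edge b a" if ab: "a \<in> S" "b \<in> S" "a \<noteq> b" for a b
    proof -
      obtain u v where "u \<in> pverts T" "v \<in> pverts T" "a = f u" "b = f v" "u \<noteq> v"
        using ab by (auto simp: S_def)
      then have "(a, b) \<in> parcs D' \<or> (b, a) \<in> parcs D'"
        using tT(1) f(3) unfolding tournament_def by metis
      then show ?thesis using sub by blast
    qed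
    have "map (\<lambda>(i, j). x i * n + x j) (index_pairs k) \<in> pattern_rel edge adjacent n (index_pairs k)"
    proof -
      have "x i < x j \<and> x j < n \<and> holds edge [x i, x j] (adjacent 0 1)"
        if "1 \<le> i" "i < j" "j \<le> k" for i j
        using x_less[OF that] x_in[of i] x_in[of j] adj[of "x i" "x j"] S(3) that
        by (auto simp: adjacent_def)
      then show ?thesis unfolding pattern_rel_def set_index_pairs by blast
    qed
    then have "map h (map (\<lambda>(i, j). x i * n + x j) (index_pairs k)) \<in> free_tournament_rel F k"
      using assms(1) k unfolding respects_cliques_def by blast
    then obtain T' where T': "tournament T'" "pverts T' = {1..k}" "free_of F T'"
      "map h (map (\<lambda>(i, j). x i * n + x j) (index_pairs k)) = tournament_vec k T'"
      unfolding free_tournament_rel_def by blast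
    have vec: "h (x i * n + x j) = (if (i, j) \<in> parcs T' then 1 else 0)"
      if "1 \<le> i" "i < j" "j \<le> k" for i j
      using T'(4) that set_index_pairs[of k] by (auto simp: tournament_vec_def)
    have less_case: "(i, j) \<in> parcs T' \<longleftrightarrow> (x i, x j) \<in> parcs D'" if "1 \<le> i" "i < j" "j \<le> k" for i j
      using vec[OF that] x_less[OF that] adj[of "x i" "x j"] x_in[of i] x_in[of j] that
      by (auto simp: D'_def)
    have arcs: "(i, j) \<in> parcs T' \<longleftrightarrow> (x i, x j) \<in> parcs D'" if ij: "i \<in> {1..k}" "j \<in> {1..k}" for i j
    proof (cases i j rule: linorder_cases)
      case less
      then show ?thesis using less_case ij by simp
    next
      case equal
      have "(i, i) \<notin> parcs T'" using T'(1) unfolding tournament_def oriented_graph_def by blast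
      moreover have "(x i, x i) \<notin> parcs D'" using edgeD[of "x i" "x i"] sub by blast
      ultimately show ?thesis using equal by simp
    next
      case greater
      have "(i, j) \<in> parcs T' \<longleftrightarrow> (j, i) \<notin> parcs T'"
        using T'(1,2) ij greater unfolding tournament_def oriented_graph_def by (metis less_irrefl)
      also have "\<dots> \<longleftrightarrow> (x j, x i) \<notin> parcs D'" using less_case[of j i] ij greater by simp
      also have "\<dots> \<longleftrightarrow> (x i, x j) \<in> parcs D'"
        using anti[of "x i" "x j"] adj[of "x i" "x j"] x_in ij x_less[of j i] greater by force
      finally show ?thesis .
    qed
    \<comment> \<open>The embedding into \<open>D'\<close>, followed by the inverse of the
      enumeration of the clique.\<close>
    define g where "g = inv_into {1..k} x \<circ> f"
    have fx: "f u \<in> x ` {1..k}" if "u \<in> pverts T" for u using x_surj that by (auto simp: S_def)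
    have g: "g u \<in> {1..k}" "x (g u) = f u" if "u \<in> pverts T" for u
      using inv_into_into[OF fx[OF that]] f_inv_into_f[OF fx[OF that]] by (simp_all add: g_def)
    have "embeds T T'"
      unfolding embeds_def
    proof (intro exI conjI ballI)
      show "inj_on g (pverts T)" using f(1) g(2) by (metis inj_on_def)
      show "g ` pverts T \<subseteq> pverts T'" using g(1) T'(2) by blast
      show "(u, v) \<in> parcs T \<longleftrightarrow> (g u, g v) \<in> parcs T'" if "u \<in> pverts T" "v \<in> pverts T" for u v
        using f(3)[OF that] arcs[OF g(1) g(1)] g(2) that by simp
    qed
    then show False using T'(3) T(1) by (auto simp: free_of_def)
  qed
  ultimately show ?thesis by blast
qed

lemma completion_iff_homomorphism:
  "(\<exists>D'. orientation_completion_of D' D \<and> free_of F D') \<longleftrightarrow>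
    (\<exists>h. homomorphism (bool_sig_consts F) h
      (pattern_structure (clique_specs (max_order F) @ const_specs) D) (bool_structure_consts F))"
  using completion_imp_respects respects_imp_completion homomorphism_const_specs by blast

text \<open>All edges of a graph are symmetric, so having it as symmetric closure without containing
  opposite arcs means keeping exactly one direction of each edge.\<close>

lemma orientation_of_iff:
  assumes "pair_graph D"
  shows "orientation_of D' D \<longleftrightarrow> orientation_completion_of D' D"
proof -
  interpret pair_graph D by (rule assms)
  have sym: "edge a b \<longleftrightarrow> edge b a" for a b using arcs_symmetric by blast
  show ?thesis
  proof
    assume o: "orientation_of D' D"
    then have eq: "mk_symmetric (with_proj D') = D" by (simp add: orientation_of_def)
    have "pverts D = pverts D'" "parcs D = parcs D' \<union> (parcs D')\<inverse>"
      using pverts_mk_symmetric[of "with_proj D'"] parcs_mk_symmetric_with_proj[of D'] unfolding eq by simp_all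
    then show "orientation_completion_of D' D"
      using o by (auto simp: orientation_of_def oriented_graph_def orientation_completion_of_def)
  next
    assume c: "orientation_completion_of D' D"
    have sub: "parcs D' \<subseteq> parcs D" and vs: "pverts D' = pverts D"
      using c by (auto simp: orientation_completion_of_def)
    have iff: "(a, b) \<in> parcs D' \<longleftrightarrow> (b, a) \<notin> parcs D'" if "edge a b" for a b
      using c that sym unfolding orientation_completion_of_def by metis
    have "pair_loopfree_digraph D'"
      by unfold_locales (use sub vs D(2) edgeD in fastforce)+
    moreover have "\<not> ((a, b) \<in> parcs D' \<and> (b, a) \<in> parcs D')" for a b using iff sub by blast
    moreover have "mk_symmetric (with_proj D') = D"
    proof -
      have "parcs D \<subseteq> parcs D' \<union> (parcs D')\<inverse>"
      proof (rule subrelI)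
        fix a b assume "edge a b"
        then show "(a, b) \<in> parcs D' \<union> (parcs D')\<inverse>" using iff by blast
      qed
      moreover have "parcs D' \<union> (parcs D')\<inverse> \<subseteq> parcs D" using sub sym by blast
      ultimately show ?thesis
        by (intro pair_pre_digraph.equality) (auto simp: parcs_mk_symmetric_with_proj vs)
    qed
    ultimately show "orientation_of D' D" unfolding orientation_of_def oriented_graph_def by blast
  qed
qed

lemma orientation_iff_homomorphism:
  assumes "pair_graph D"
  shows "(\<exists>D'. orientation_of D' D \<and> free_of F D') \<longleftrightarrow>
    (\<exists>h. homomorphism (bool_sig F) h (pattern_structure (clique_specs (max_order F)) D)
      (bool_structure F))"
proof -
  interpret pair_graph D by (rule assms)
  have "respects_arcs h" for h unfolding respects_arcs_def using arcs_symmetric by blast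
  then show ?thesis
    unfolding orientation_of_iff[OF assms] homomorphism_clique_specs
    using completion_imp_respects respects_imp_completion by blast
qed

end

theorem theorem4p2:
  fixes F :: "'v pair_pre_digraph set"
  assumes "finite F"
    and "\<forall>T\<in>F. tournament T \<and> finite (pverts T) \<and> 2 \<le> card (pverts T)"
  shows "polytime_reducible (orientation_problem F) (CSP (bool_sig F) (bool_structure F)) \<and>
    polytime_reducible (orientation_completion_problem F)
      (CSP (bool_sig_consts F) (bool_structure_consts F))"
proof
  have specs: "\<forall>(\<alpha>, ps)\<in>set (clique_specs m @ const_specs). binary_formula \<alpha>" for m
    by (auto simp: clique_specs_def const_specs_def binary_formulas)
  let ?cs = "clique_specs (max_order F)"
  have "polytime_reduction (orientation_problem F)
      (CSP (pattern_sig ?cs) (bool_structure F)) (pattern_structure ?cs)"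
  proof (rule polytime_reduction_pattern_structure)
    show "\<forall>(\<alpha>, ps)\<in>set ?cs. binary_formula \<alpha>" using specs by auto
    fix G assume "G \<in> instances (orientation_problem F)"
    then obtain n where G: "pair_graph G" "pverts G = {..<n}" by (auto simp: orientation_problem_def)
    then have "pair_digraph G" by (simp add: pair_graph_def)
    from orientation_iff_homomorphism[OF assms this G(2) G(1)]
    show "yes_instance (orientation_problem F) G \<longleftrightarrow>
      (\<exists>h. homomorphism (pattern_sig ?cs) h (pattern_structure ?cs G) (bool_structure F))"
      by (simp add: orientation_problem_def pattern_sig_clique_specs)
  qed (simp add: orientation_problem_def)
  then show "polytime_reducible (orientation_problem F) (CSP (bool_sig F) (bool_structure F))"
    unfolding polytime_reducible_def pattern_sig_clique_specs by blast
  have "polytime_reduction (orientation_completion_problem F)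
      (CSP (pattern_sig (?cs @ const_specs)) (bool_structure_consts F))
      (pattern_structure (?cs @ const_specs))"
  proof (rule polytime_reduction_pattern_structure[OF specs])
    fix D assume "D \<in> instances (orientation_completion_problem F)"
    then obtain n where D: "pair_digraph D" "pverts D = {..<n}"
      by (auto simp: orientation_completion_problem_def)
    from completion_iff_homomorphism[OF assms this]
    show "yes_instance (orientation_completion_problem F) D \<longleftrightarrow>
      (\<exists>h. homomorphism (pattern_sig (?cs @ const_specs)) h
        (pattern_structure (?cs @ const_specs) D) (bool_structure_consts F))"
      by (simp add: orientation_completion_problem_def pattern_sig_const_specs)
  qed (simp add: orientation_completion_problem_def)
  then show "polytime_reducible (orientation_completion_problem F)
      (CSP (bool_sig_consts F) (bool_structure_consts F))"
    unfolding polytime_reducible_def pattern_sig_const_specs by blast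
qed

end
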